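(* Assume the Kernel conjecture, i.e. $\ker(D_{<M})\cap\mathcal Z^{\mathfrak f}_M=\mathbb Q\,\zeta^{\mathfrak f}(M)$ for all $M\ge2$. Let $r,\ell\ge1$ and $N\ge2r+1$. Then for every $\xi\in(F_\ell\mathcal Z^{\mathfrak f}_{2,3})_N$ one has $D_{2r+1}(\xi)\in\mathcal L^{\mathfrak f}_{2r+1}\otimes F_{\ell-1}\mathcal Z^{\mathfrak f}_{2,3}$ and $D_{2r+1}(\xi)\in\mathbb Q\,\zeta^{\mathfrak f}_{2r+1}\otimes(F_{\ell-1}\mathcal Z^{\mathfrak f}_{2,3})_{N-2r-1}+\mathcal L^{\mathfrak f}_{2r+1}\otimes F_{\ell-2}\mathcal Z^{\mathfrak f}_{2,3}$; i.e. the induced map $D^{(\ell)}_{2r+1}:\operatorname{gr}^F_\ell(\mathcal Z^{\mathfrak f}_{2,3})_N\to\mathcal L^{\mathfrak f}_{2r+1}\otimes\operatorname{gr}^F_{\ell-1}(\mathcal Z^{\mathfrak f}_{2,3})_{N-2r-1}$ takes values in $\mathbb Q\,\zeta^{\mathfrak f}_{2r+1}\otimes\operatorname{gr}^F_{\ell-1}(\mathcal Z^{\mathfrak f}_{2,3})_{N-2r-1}$.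
   Context: Formal MZVs: $\mathcal X=\{x_0,x_1\}$, $\mathbb Q\langle\mathcal X\rangle$ free noncommutative polynomials (weight = number of letters), $ш$ shuffle product. $\mathcal Z^{\mathfrak f}=(\mathbb Q\langle\mathcal X\rangle,ш)/R$, $R$ the ideal generated by $x_0,x_1$ and $uш v-\iota(\iota^{-1}(u)*\iota^{-1}(v))$ for $u\in\mathbb Q\mathbf1+x_0\mathbb Q\langle\mathcal X\rangle x_1$, $v\in\mathbb Q\mathbf1+\mathbb Q\langle\mathcal X\rangle x_1$, with $\iota(y_{k_1}\cdots y_{k_d})=x_0^{k_1-1}x_1\cdots x_0^{k_d-1}x_1$ and $*$ the stuffle product ($y_iu*y_jv=y_i(u*y_jv)+y_j(y_iu*v)+y_{i+j}(u*v)$). $\zeta^{\mathfrak f}(k_1,\dots,k_d)$ is the class of $x_0^{k_1-1}x_1\cdots x_0^{k_d-1}x_1$; $\mathcal Z^{\mathfrak f}_N$ weight-$N$ part. $\mathcal Z^{\mathfrak f}_{2,3}=\operatorname{span}\{\zeta^{\mathfrak f}(k_1,\dots,k_d):k_i\in\{2,3\}\}$; $F_\ell\mathcal Z^{\mathfrak f}_{2,3}$ is spanned by those with at most $\ell$ indices equal to $3$ ($F_{-1}=0$), $\operatorname{gr}^F_\ell=F_\ell/F_{\ell-1}$, and subscripts denote weight components. $\mathcal A^{\mathfrak f}=\mathcal Z^{\mathfrak f}/(\zeta^{\mathfrak f}(2))$, $\alpha$ the projection; Goncharov coaction $\Delta_{\mathrm{Gon}}:\mathcal Z^{\mathfrak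 f}\to\mathcal A^{\mathfrak f}\otimes\mathcal Z^{\mathfrak f}$, $\zeta^{\mathfrak f}(w)\mapsto(\alpha\circ\zeta^{\mathfrak f}\otimes\zeta^{\mathfrak f})(\Delta_{\mathrm{Gon}}(w))$ with $\Delta_{\mathrm{Gon}}(\varepsilon_1\cdots\varepsilon_n)=\sum_k\sum_{0<i_1<\dots<i_k<n+1}\big(\mathop{ш}_{p=0}^kI(\varepsilon_{i_p};\varepsilon_{i_p+1}\cdots\varepsilon_{i_{p+1}-1};\varepsilon_{i_{p+1}})\big)\otimes\varepsilon_{i_1}\cdots\varepsilon_{i_k}$ ($i_0=0,i_{k+1}=n+1,\varepsilon_0=x_1,\varepsilon_{n+1}=x_0$; $I(x_1;f;x_0)=f$, $I(x_0;f;x_1)=S(f)$, $S(\varepsilon_1\cdots\varepsilon_m)=(-1)^m\varepsilon_m\cdots\varepsilon_1$, $I(\varepsilon;f;\varepsilon)$ = coefficient of $\mathbf1$ in $f$ times $\mathbf1$). $\mathcal L^{\mathfrak f}=\mathcal A^{\mathfrak f}_{>0}/(\mathcal A^{\mathfrak f}_{>0})^2$, $\pi_{2r+1}:\mathcal A^{\mathfrak f}_{>0}\to\mathcal L^{\mathfrak f}_{2r+1}$ the projection, $D_{2r+1}=(\pi_{2r+1}\otimes\mathrm{id})\circ(\Delta_{\mathrm{Gon}}-\mathbf1\otimes\mathrm{id})$, $D_{<M}=\bigoplus_{3\le2r+1<M}D_{2r+1}$, and $\zeta^{\mathfrak f}_{2r+1}=\pi_{2r+1}(\alpha(\zeta^{\mathfrak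 f}(2r+1)))$. *)

theory Defs
  imports Complex_Main "HOL-Library.Poly_Mapping"
begin

datatype letter = X0 | X1

type_synonym word = "letter list"
type_synonym qpoly = "word \<Rightarrow>\<^sub>0 rat"            \<comment> \<open>Q<X>, weight = length of a word\<close>
type_synonym qtens = "(word \<times> word) \<Rightarrow>\<^sub>0 rat"

definition sc :: "rat \<Rightarrow> ('k \<Rightarrow>\<^sub>0 rat) \<Rightarrow> ('k \<Rightarrow>\<^sub>0 rat)" where
  "sc c p = Poly_Mapping.map (\<lambda>x. c * x) p"

definition wd :: "'k \<Rightarrow> ('k \<Rightarrow>\<^sub>0 rat)" where
  "wd w = Poly_Mapping.single w 1"

definition lspan :: "('k \<Rightarrow>\<^sub>0 rat) set \<Rightarrow> ('k \<Rightarrow>\<^sub>0 rat) set" where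
  "lspan S = {p. \<exists>F c. finite F \<and> F \<subseteq> S \<and> p = (\<Sum>s\<in>F. sc (c s) s)}"

definition homog :: "nat \<Rightarrow> qpoly \<Rightarrow> bool" where
  "homog n p \<longleftrightarrow> (\<forall>u\<in>Poly_Mapping.keys p. length u = n)"

fun shl :: "'a list \<Rightarrow> 'a list \<Rightarrow> 'a list list" where
  "shl [] v = [v]"
| "shl u [] = [u]"
| "shl (a # u) (b # v) = map ((#) a) (shl u (b # v)) @ map ((#) b) (shl (a # u) v)"

definition wsh :: "word \<Rightarrow> word \<Rightarrow> qpoly" where
  "wsh u v = (\<Sum>w\<leftarrow>shl u v. wd w)"

definition psh :: "qpoly \<Rightarrow> qpoly \<Rightarrow> qpoly" where
  "psh p q = (\<Sum>u\<in>Poly_Mapping.keys p. \<Sum>v\<in>Poly_Mapping.keys q.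
      sc (Poly_Mapping.lookup p u * Poly_Mapping.lookup q v) (wsh u v))"

text \<open>list of all terms of the stuffle product of two y-words (indices k_i), with multiplicity\<close>
fun stl :: "nat list \<Rightarrow> nat list \<Rightarrow> nat list list" where
  "stl [] v = [v]"
| "stl u [] = [u]"
| "stl (i # u) (j # v) = map ((#) i) (stl u (j # v)) @ map ((#) j) (stl (i # u) v)
      @ map ((#) (i + j)) (stl u v)"

definition iota :: "nat list \<Rightarrow> word" where
  "iota ks = concat (map (\<lambda>k. replicate (k - 1) X0 @ [X1]) ks)"

text \<open>double shuffle generators  u sh v - iota(iota^-1 u * iota^-1 v), with u running through
  the basis words 1, x0...x1 of Q1 + x0 Q<X> x1 and v through the basis words of Q1 + Q<X> x1
  (the expression is bilinear in u, v)\<close>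
definition dsgen :: "qpoly set" where
  "dsgen = {wsh (iota ks) (iota ls) - (\<Sum>m\<leftarrow>stl ks ls. wd (iota m)) | ks ls.
              (\<forall>k\<in>set ks. k \<ge> 1) \<and> (\<forall>l\<in>set ls. l \<ge> 1) \<and> (ks = [] \<or> hd ks \<ge> 2)}"

definition shideal :: "qpoly set \<Rightarrow> qpoly set" where
  "shideal G = lspan {psh g u | g u. g \<in> G}"

text \<open>the ideal R; Z^f = (Q<X>, sh)/R\<close>
definition Rid :: "qpoly set" where
  "Rid = shideal ({wd [X0], wd [X1]} \<union> dsgen)"

text \<open>preimage in Q<X> of the ideal defining L^f = A^f_{>0}/(A^f_{>0})^2, A^f = Z^f/(zeta(2)):
  R + (x0 x1) + products of two elements of positive weight\<close>
definition ILid :: "qpoly set" where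
  "ILid = lspan (Rid \<union> shideal {wd [X0, X1]}
      \<union> {psh u v | u v. Poly_Mapping.lookup u [] = 0 \<and> Poly_Mapping.lookup v [] = 0})"

definition zw :: "nat \<Rightarrow> word" where
  "zw k = iota [k]"

text \<open>representatives of (F_l Z_{2,3})_N (l an integer, F_l = 0 for l < 0) and of F_l Z_{2,3}\<close>
definition zgen :: "int \<Rightarrow> nat \<Rightarrow> qpoly set" where
  "zgen l N = {wd (iota ks) | ks. set ks \<subseteq> {2, 3} \<and> sum_list ks = N
                   \<and> int (count_list ks 3) \<le> l}"

definition Fw :: "int \<Rightarrow> nat \<Rightarrow> qpoly set" where
  "Fw l N = lspan (zgen l N)"

definition Fall :: "int \<Rightarrow> qpoly set" where
  "Fall l = lspan (\<Union>N. zgen l N)"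

definition tens :: "qpoly \<Rightarrow> qpoly \<Rightarrow> qtens" where
  "tens p q = (\<Sum>u\<in>Poly_Mapping.keys p. \<Sum>v\<in>Poly_Mapping.keys q.
      sc (Poly_Mapping.lookup p u * Poly_Mapping.lookup q v) (wd (u, v)))"

definition antip :: "word \<Rightarrow> qpoly" where
  "antip f = sc ((-1) ^ length f) (wd (rev f))"

definition Igon :: "letter \<Rightarrow> word \<Rightarrow> letter \<Rightarrow> qpoly" where
  "Igon a f b = (if a = X1 \<and> b = X0 then wd f
                 else if a = X0 \<and> b = X1 then antip f
                 else if f = [] then wd [] else 0)"

definition gon_word :: "word \<Rightarrow> qtens" where
  "gon_word e = (let n = length e; ext = X1 # e @ [X0] in
     (\<Sum>S\<in>Pow {1..n}.
        let idx = 0 # sorted_list_of_set S @ [n + 1] in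
        tens (foldr psh
                (map (\<lambda>p. Igon (ext ! (idx ! p))
                               (take (idx ! (Suc p) - idx ! p - 1) (drop (idx ! p + 1) ext))
                               (ext ! (idx ! (Suc p))))
                     [0..<card S + 1])
                (wd []))
             (wd (map (\<lambda>i. ext ! i) (sorted_list_of_set S)))))"

definition gon :: "qpoly \<Rightarrow> qtens" where
  "gon p = (\<Sum>u\<in>Poly_Mapping.keys p. sc (Poly_Mapping.lookup p u) (gon_word u))"

definition projL :: "nat \<Rightarrow> qtens \<Rightarrow> qtens" where
  "projL n T = (\<Sum>x\<in>Poly_Mapping.keys T.
      if length (fst x) = n then sc (Poly_Mapping.lookup T x) (wd x) else 0)"

text \<open>representative in Q<X>_n (x) Q<X> of D_n(xi), xi the class of p:
  (pi_n (x) id)(Delta_Gon - 1 (x) id)\<close>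
definition Drep :: "nat \<Rightarrow> qpoly \<Rightarrow> qtens" where
  "Drep n p = projL n (gon p - tens (wd []) p)"

text \<open>kernel of Q<X>_n (x) Q<X>  \<rightarrow>  L^f_n (x) Z^f\<close>
definition Krel :: "nat \<Rightarrow> qtens set" where
  "Krel n = lspan {tens a b | a b. homog n a \<and> (a \<in> ILid \<or> b \<in> Rid)}"

text \<open>representatives of L^f_n (x) W for a subspace W (given by representatives)\<close>
definition LTens :: "nat \<Rightarrow> qpoly set \<Rightarrow> qtens set" where
  "LTens n W = lspan {tens a b | a b. homog n a \<and> b \<in> W}"

definition kernel_conjecture :: bool where
  "kernel_conjecture \<longleftrightarrow> (\<forall>M\<ge>2. \<forall>p. homog M p \<longrightarrow>
      ((\<forall>r\<ge>1. 2 * r + 1 < M \<longrightarrow> Drep (2 * r + 1) p \<in> Krel (2 * r + 1))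
        \<longleftrightarrow> (\<exists>c. p - sc c (wd (zw M)) \<in> Rid)))"

end

theory Submission
  imports Defs
begin

text \<open>Modulo products, only the summands of the Goncharov coaction that cut out a single interval
  \<open>f\<close> with distinct neighbouring letters contribute to \<open>D\<close>. In a word of 2's and 3's, padded by
  \<open>x1\<close> on the left and \<open>x0\<close> on the right, there is no factor \<open>x1 x1\<close> or \<open>x0 x0 x0\<close>, and this
  persists after the cut because the neighbours differ. The number of 3's drops by
  \<open>length f - 2 * (number of x1 in f)\<close>, which is nonnegative and odd. If the drop is exactly 1 then
  \<open>f\<close> or its reversal is \<open>(x0 x1)^i x0 (x0 x1)^j\<close>, and it remains to see that such a word is a
  multiple of \<open>zeta(2r+1)\<close> modulo products. For \<open>j > 0\<close>, by induction on the weight, the image of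
  this word under every lower \<open>D\<close> is a multiple of \<open>zeta(2q+1) (x) (x0 x1)^k\<close>; as \<open>D\<close> is a
  derivation, subtracting multiples of the products \<open>zeta(2q+1) sh (x0 x1)^k\<close> produces an element
  of the kernel, to which the kernel conjecture applies. The case \<open>j = 0\<close> reduces to \<open>j > 0\<close> by
  expanding \<open>x0 sh (x0 x1)^i\<close>.\<close>

section \<open>Linear algebra of finitely supported functions over the rationals\<close>

lemma lookup_sc [simp]: "Poly_Mapping.lookup (sc c p) k = c * Poly_Mapping.lookup p k"
  by (simp add: sc_def Poly_Mapping.map.rep_eq when_def)

interpretation qv: vector_space "sc :: rat \<Rightarrow> ('k \<Rightarrow>\<^sub>0 rat) \<Rightarrow> ('k \<Rightarrow>\<^sub>0 rat)"
  by unfold_locales (auto intro!: poly_mapping_eqI simp: lookup_add algebra_simps)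

lemma lspan_eq_span: "lspan S = qv.span S"
  unfolding lspan_def qv.span_explicit by blast

text \<open>Linear extension of a map given on basis elements. The shuffle, the tensor product, the
  coaction and the projection are all rewritten through it, so that linearity is proved only
  once.\<close>

definition lext :: "('k \<Rightarrow> ('m \<Rightarrow>\<^sub>0 rat)) \<Rightarrow> ('k \<Rightarrow>\<^sub>0 rat) \<Rightarrow> ('m \<Rightarrow>\<^sub>0 rat)" where
  "lext f p = (\<Sum>u\<in>Poly_Mapping.keys p. sc (Poly_Mapping.lookup p u) (f u))"

text \<open>Additional indices contribute zero terms. This puts \<open>p\<close>, \<open>q\<close>
  and \<open>p + q\<close>, whose supports differ, on a common index set.\<close>

lemma lext_superset:
  assumes "finite A" "Poly_Mapping.keys p \<subseteq> A"
  shows "lext f p = (\<Sum>u\<in>A. sc (Poly_Mapping.lookup p u) (f u))"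
  unfolding lext_def using assms
  by (intro sum.mono_neutral_left) (auto simp: in_keys_iff)

lemma lext_add: "lext f (p + q) = lext f p + lext f q"
proof -
  let ?A = "Poly_Mapping.keys p \<union> Poly_Mapping.keys q"
  have "lext f (p + q) = (\<Sum>u\<in>?A. sc (Poly_Mapping.lookup (p + q) u) (f u))"
    by (rule lext_superset) (auto dest: subsetD[OF Poly_Mapping.keys_add])
  also have "\<dots> = lext f p + lext f q"
    by (simp add: lext_superset[of ?A] lookup_add qv.scale_left_distrib sum.distrib)
  finally show ?thesis .
qed

lemma lext_sc: "lext f (sc c p) = sc c (lext f p)"
proof -
  have "lext f (sc c p) = (\<Sum>u\<in>Poly_Mapping.keys p. sc (Poly_Mapping.lookup (sc c p) u) (f u))"
    by (rule lext_superset) (auto simp: in_keys_iff)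
  also have "\<dots> = sc c (lext f p)"
    by (simp add: lext_def qv.scale_sum_right)
  finally show ?thesis .
qed

lemma lext_wd [simp]: "lext f (wd w) = f w"
  by (simp add: lext_def wd_def)

lemma lext_0 [simp]: "lext f 0 = 0"
  by (simp add: lext_def)

lemma lext_diff: "lext f (p - q) = lext f p - lext f q"
  using lext_add[of f "p - q" q] by (simp add: algebra_simps)

lemma lext_uminus: "lext f (- p) = - lext f p"
  using lext_diff[of f 0 p] by simp

lemma lext_sum: "lext f (\<Sum>i\<in>A. g i) = (\<Sum>i\<in>A. lext f (g i))"
  by (induction A rule: infinite_finite_induct) (auto simp: lext_add)

lemma lext_sum_list: "lext f (\<Sum>x\<leftarrow>xs. g x) = (\<Sum>x\<leftarrow>xs. lext f (g x))"
  by (induction xs) (auto simp: lext_add)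

lemmas lext_lin = lext_add lext_sc lext_diff lext_uminus lext_sum

lemma lext_wd_id: "lext wd p = p"
  by (rule poly_mapping_eqI)
    (simp add: lext_def wd_def lookup_sum lookup_single when_def if_distrib in_keys_iff
      cong: if_cong)

lemma lext_lext: "lext f (lext g p) = lext (\<lambda>w. lext f (g w)) p"
  by (simp add: lext_def[of g] lext_def[of "\<lambda>w. lext f (g w)"] lext_sum lext_sc)

lemma lext_fun_add: "lext (\<lambda>w. f w + g w) p = lext f p + lext g p"
  by (simp add: lext_def qv.scale_right_distrib sum.distrib)

lemma lext_fun_sc: "lext (\<lambda>w. sc c (f w)) p = sc c (lext f p)"
  by (simp add: lext_def qv.scale_sum_right mult.commute)

lemma lext_fun_0 [simp]: "lext (\<lambda>w. 0) p = 0"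
  by (simp add: lext_def)

lemma lext_fun_diff: "lext (\<lambda>w. f w - g w) p = lext f p - lext g p"
  using lext_fun_add[of "\<lambda>w. f w - g w" g p] by simp

lemma lext_in_subspace:
  assumes "qv.subspace V" "\<And>w. w \<in> Poly_Mapping.keys p \<Longrightarrow> f w \<in> V"
  shows "lext f p \<in> V"
  unfolding lext_def using assms by (auto intro!: qv.subspace_sum qv.subspace_scale)

lemma lext_span:
  assumes "p \<in> qv.span S" "\<And>s. s \<in> S \<Longrightarrow> lext f s \<in> V" "qv.subspace V"
  shows "lext f p \<in> V"
  using assms(1)
proof (induction rule: qv.span_induct_alt)
  case base
  then show ?case using assms by (simp add: qv.subspace_0)
next
  case (step c x y)
  then show ?case using assms
    by (simp add: lext_lin qv.subspace_add qv.subspace_scale)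
qed

section \<open>Shuffle, tensor product and coaction as linear extensions\<close>

lemma psh_lext: "psh p q = lext (\<lambda>u. lext (\<lambda>v. wsh u v) q) p"
  by (simp add: psh_def lext_def qv.scale_sum_right)

lemma tens_lext: "tens p q = lext (\<lambda>u. lext (\<lambda>v. wd (u, v)) q) p"
  by (simp add: tens_def lext_def qv.scale_sum_right)

lemma gon_lext: "gon p = lext gon_word p"
  by (simp add: gon_def lext_def)

lemma projL_lext: "projL n T = lext (\<lambda>x. if length (fst x) = n then wd x else 0) T"
  unfolding projL_def lext_def by (rule sum.cong) auto

lemma psh_wd [simp]: "psh (wd u) (wd v) = wsh u v"
  by (simp add: psh_lext)

lemma tens_wd [simp]: "tens (wd u) (wd v) = wd (u, v)"
  by (simp add: tens_lext)

lemma tens_add_left: "tens (p + p') q = tens p q + tens p' q"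
  and tens_sc_left: "tens (sc c p) q = sc c (tens p q)"
  and tens_diff_left: "tens (p - p') q = tens p q - tens p' q"
  and tens_0_left [simp]: "tens 0 q = 0"
  by (simp_all add: tens_lext lext_lin)

lemma tens_add_right: "tens p (q + q') = tens p q + tens p q'"
  and tens_sc_right: "tens p (sc c q) = sc c (tens p q)"
  and tens_diff_right: "tens p (q - q') = tens p q - tens p q'"
  and tens_0_right [simp]: "tens p 0 = 0"
  by (simp_all add: tens_lext lext_lin lext_fun_add lext_fun_sc lext_fun_diff)

lemma wsh_Nil [simp]: "wsh [] v = wd v" "wsh u [] = wd u"
  by (simp add: wsh_def) (cases u; simp add: wsh_def)

lemma psh_1_left [simp]: "psh (wd []) p = p"
proof -
  have "wsh [] = wd" by (rule ext) simp
  then show ?thesis by (simp add: psh_lext lext_wd_id)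
qed

lemma psh_1_right [simp]: "psh p (wd []) = p"
  by (simp add: psh_lext lext_wd_id)

text \<open>Turns the list recursion of \<open>shl\<close> into the identity \<open>wsh_Cons\<close>
  between polynomials.\<close>

definition pcons :: "'a \<Rightarrow> ('a list \<Rightarrow>\<^sub>0 rat) \<Rightarrow> ('a list \<Rightarrow>\<^sub>0 rat)" where
  "pcons a = lext (\<lambda>w. wd (a # w))"

lemma pcons_wd [simp]: "pcons a (wd w) = wd (a # w)"
  by (simp add: pcons_def)

lemma wsh_Cons: "wsh (a # u) (b # v) = pcons a (wsh u (b # v)) + pcons b (wsh (a # u) v)"
  by (simp add: wsh_def pcons_def lext_sum_list comp_def)

lemma wsh_commute: "wsh u v = wsh v u"
  by (induction u v rule: shl.induct) (auto simp: wsh_Cons add.commute)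

section \<open>Homogeneous polynomials\<close>

lemma homog_add: "homog n p \<Longrightarrow> homog n q \<Longrightarrow> homog n (p + q)"
  unfolding homog_def by (auto dest: subsetD[OF Poly_Mapping.keys_add])

lemma homog_sc: "homog n p \<Longrightarrow> homog n (sc c p)"
  unfolding homog_def by (auto simp: in_keys_iff)

lemma homog_0 [simp]: "homog n 0"
  by (simp add: homog_def)

lemma subspace_homog: "qv.subspace {p. homog n p}"
  by (rule qv.subspaceI) (auto intro: homog_add homog_sc)

lemma homog_diff: "homog n p \<Longrightarrow> homog n q \<Longrightarrow> homog n (p - q)"
  using qv.subspace_diff[OF subspace_homog] by blast

lemma homog_sum: "(\<And>i. i \<in> A \<Longrightarrow> homog n (f i)) \<Longrightarrow> homog n (sum f A)"
  using qv.subspace_sum[OF subspace_homog, of A f n] by blast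

lemma homog_wd: "homog n (wd w) \<longleftrightarrow> length w = n"
  by (simp add: homog_def wd_def)

lemma homog_lext: "(\<And>w. w \<in> Poly_Mapping.keys p \<Longrightarrow> homog n (f w)) \<Longrightarrow> homog n (lext f p)"
  using lext_in_subspace[OF subspace_homog, of p f n] by simp

lemma homog_pcons: "homog n p \<Longrightarrow> homog (Suc n) (pcons a p)"
  unfolding pcons_def by (rule homog_lext) (auto simp: homog_wd homog_def[of n])

lemma homog_wsh: "homog (length u + length v) (wsh u v)"
  by (induction u v rule: shl.induct)
    (auto simp: wsh_Cons homog_wd intro!: homog_add dest: homog_pcons)

lemma homog_psh: "homog m p \<Longrightarrow> homog n q \<Longrightarrow> homog (m + n) (psh p q)"
  unfolding psh_lext by (intro homog_lext) (metis homog_def homog_wsh)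

lemma homog_const: "homog n p \<Longrightarrow> n \<noteq> 0 \<Longrightarrow> Poly_Mapping.lookup p [] = 0"
  by (auto simp: homog_def in_keys_iff)

section \<open>Products and the antipode modulo \<open>ILid\<close>\<close>

lemma subspace_ILid: "qv.subspace ILid"
  by (simp add: ILid_def lspan_eq_span)

lemma Rid_subset_ILid: "Rid \<subseteq> ILid"
  unfolding ILid_def lspan_eq_span by (auto intro: qv.span_base)

lemma psh_in_ILid:
  "Poly_Mapping.lookup p [] = 0 \<Longrightarrow> Poly_Mapping.lookup q [] = 0 \<Longrightarrow> psh p q \<in> ILid"
  unfolding ILid_def lspan_eq_span by (rule qv.span_base) blast

lemma wsh_in_ILid: "u \<noteq> [] \<Longrightarrow> v \<noteq> [] \<Longrightarrow> wsh u v \<in> ILid"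
  using psh_in_ILid[of "wd u" "wd v"] by (simp add: wd_def[of u] wd_def[of v] lookup_single)
    (simp flip: wd_def)

text \<open>Modulo products, only the last term survives in the telescoping sum of
  \<open>(-1)^k (rev v' @ a # u) sh v''\<close> over all splittings \<open>v = v' @ v''\<close> with \<open>k = length v'\<close>.\<close>
lemma rev_antipode_ILid:
  "sc ((-1) ^ length v) (wd (rev v @ a # u)) - pcons a (wsh u v) \<in> ILid"
proof (induction v arbitrary: a u)
  case Nil
  then show ?case using qv.subspace_0[OF subspace_ILid] by simp
next
  case (Cons b v)
  have "sc ((-1) ^ length (b # v)) (wd (rev (b # v) @ a # u)) - pcons a (wsh u (b # v))
    = - (sc ((-1) ^ length v) (wd (rev v @ b # a # u)) - pcons b (wsh (a # u) v))
      - wsh (a # u) (b # v)"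
    by (simp add: wsh_Cons)
  also have "\<dots> \<in> ILid"
    by (intro qv.subspace_diff[OF subspace_ILid] qv.subspace_neg[OF subspace_ILid] Cons wsh_in_ILid)
      auto
  finally show ?case .
qed

text \<open>The case \<open>u = []\<close> of \<open>rev_antipode_ILid\<close>, where the shuffle is
  the word \<open>v\<close> itself: modulo products the antipode is -1.\<close>

lemma antip_ILid:
  assumes "f \<noteq> []"
  shows "antip f + wd f \<in> ILid"
proof -
  obtain b v where f: "f = b # v" using assms by (cases f) auto
  have "antip f + wd f = - (sc ((-1) ^ length v) (wd (rev v @ [b])) - pcons b (wsh [] v))"
    by (simp add: antip_def f)
  then show ?thesis
    using qv.subspace_neg[OF subspace_ILid rev_antipode_ILid[of v b "[]"]] by simp
qed

section \<open>The derivation property\<close>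

text \<open>The part of \<open>Krel n\<close> that comes from the left factor. It is stable under
  every map \<open>tmap_right g\<close>, so letters may be prepended and words shuffled in on the
  right; the relations \<open>Rid\<close> in the right factor would not survive this in
  general.\<close>

definition ILtens :: "nat \<Rightarrow> qtens set" where
  "ILtens n = qv.span {tens a b | a b. homog n a \<and> a \<in> ILid}"

lemma subspace_ILtens [simp]: "qv.subspace (ILtens n)"
  by (simp add: ILtens_def)

lemma ILtens_subset_Krel: "ILtens n \<subseteq> Krel n"
  unfolding ILtens_def Krel_def lspan_eq_span by (rule qv.span_mono) blast

lemma tens_in_ILtens: "homog n a \<Longrightarrow> a \<in> ILid \<Longrightarrow> tens a b \<in> ILtens n"
  unfolding ILtens_def by (rule qv.span_base) blast

lemmas ILtens_add = qv.subspace_add[OF subspace_ILtens]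
lemmas ILtens_diff = qv.subspace_diff[OF subspace_ILtens]
lemmas ILtens_sc = qv.subspace_scale[OF subspace_ILtens]
lemmas ILtens_0 = qv.subspace_0[OF subspace_ILtens]
lemmas ILtens_sum = qv.subspace_sum[OF subspace_ILtens]

definition tmap_right :: "(word \<Rightarrow> qpoly) \<Rightarrow> qtens \<Rightarrow> qtens" where
  "tmap_right g = lext (\<lambda>x. tens (wd (fst x)) (g (snd x)))"

lemma tmap_right_wd [simp]: "tmap_right g (wd (f, w)) = tens (wd f) (g w)"
  by (simp add: tmap_right_def)

lemma tmap_right_lin:
  "tmap_right g (S + T) = tmap_right g S + tmap_right g T"
  "tmap_right g (sc c T) = sc c (tmap_right g T)"
  "tmap_right g (S - T) = tmap_right g S - tmap_right g T"
  "tmap_right g (- T) = - tmap_right g T"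
  "tmap_right g (\<Sum>i\<in>I. F i) = (\<Sum>i\<in>I. tmap_right g (F i))"
  "tmap_right g 0 = 0"
  by (simp_all add: tmap_right_def lext_lin)

lemma tmap_right_tens: "tmap_right g (tens p q) = tens p (lext g q)"
  by (simp add: tmap_right_def tens_lext lext_lext)

lemma tmap_right_tmap_right: "tmap_right g (tmap_right f T) = tmap_right (\<lambda>w. lext g (f w)) T"
  by (simp add: tmap_right_def[of f] tmap_right_def[of "\<lambda>w. lext g (f w)"]
      tmap_right_def[of g, symmetric] lext_lext[of _ _ T, folded tmap_right_def] tmap_right_tens)
    (simp add: tmap_right_def lext_lext flip: tmap_right_tens)

lemma tmap_right_fun_add: "tmap_right (\<lambda>w. f w + g w) T = tmap_right f T + tmap_right g T"
  by (simp add: tmap_right_def tens_add_right lext_fun_add)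

lemma tmap_right_ILtens: "T \<in> ILtens n \<Longrightarrow> tmap_right g T \<in> ILtens n"
  using lext_span[of T "{tens a b | a b. homog n a \<and> a \<in> ILid}"
      "\<lambda>x. tens (wd (fst x)) (g (snd x))" "ILtens n", folded tmap_right_def ILtens_def]
  by (force simp: tmap_right_tens tens_in_ILtens)

text \<open>The degree \<open>n\<close> part of the deconcatenation coproduct, written recursively
  to match the recursion of the shuffle; the closed form is \<open>deconc_eq\<close>.\<close>

fun deconc :: "nat \<Rightarrow> word \<Rightarrow> qtens" where
  "deconc 0 w = wd ([], w)"
| "deconc (Suc n) [] = 0"
| "deconc (Suc n) (a # w) = lext (\<lambda>x. wd (a # fst x, snd x)) (deconc n w)"

lemma deconc_eq: "deconc n w = (if n \<le> length w then wd (take n w, drop n w) else 0)"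
  by (induction n w rule: deconc.induct) auto

text \<open>Contribution of the shuffles whose prefix takes \<open>i\<close> letters from
  \<open>u\<close> and \<open>j\<close> from \<open>v\<close>. The guard matters because
  \<open>take\<close> would silently shorten the prefix.\<close>

definition deconc_wsh :: "nat \<Rightarrow> nat \<Rightarrow> word \<Rightarrow> word \<Rightarrow> qtens" where
  "deconc_wsh i j u v = (if i \<le> length u \<and> j \<le> length v
     then tens (wsh (take i u) (take j v)) (wsh (drop i u) (drop j v)) else 0)"

lemma lcons_tens: "lext (\<lambda>x. wd (a # fst x, snd x)) (tens p q) = tens (pcons a p) q"
  by (simp add: tens_lext pcons_def lext_lext)

lemma deconc_wsh_Suc_Suc:
  "deconc_wsh (Suc i) (Suc j) (a # u) (b # v) =
     lext (\<lambda>x. wd (a # fst x, snd x)) (deconc_wsh i (Suc j) u (b # v))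
   + lext (\<lambda>x. wd (b # fst x, snd x)) (deconc_wsh (Suc i) j (a # u) v)"
  by (simp add: deconc_wsh_def lcons_tens wsh_Cons tens_add_left)

lemma deconc_wsh_Suc_0:
  "deconc_wsh (Suc i) 0 (a # u) v = lext (\<lambda>x. wd (a # fst x, snd x)) (deconc_wsh i 0 u v)"
  by (simp add: deconc_wsh_def lcons_tens)

lemma deconc_wsh_0_Suc:
  "deconc_wsh 0 (Suc j) u (b # v) = lext (\<lambda>x. wd (b # fst x, snd x)) (deconc_wsh 0 j u v)"
  by (simp add: deconc_wsh_def lcons_tens)

text \<open>Deconcatenation is multiplicative for the shuffle product: a prefix of length
  \<open>n\<close> of a shuffle is a shuffle of a prefix of \<open>u\<close> with one of
  \<open>v\<close>. The induction distinguishes which word supplies the first letter.\<close>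

lemma lext_deconc_wsh: "lext (deconc n) (wsh u v) = (\<Sum>i\<le>n. deconc_wsh i (n - i) u v)"
proof (induction u v arbitrary: n rule: shl.induct)
  case (1 v)
  have "(\<Sum>i\<le>n. deconc_wsh i (n - i) [] v) = deconc_wsh 0 n [] v"
    by (subst sum.atMost_shift) (simp add: deconc_wsh_def)
  then show ?case by (simp add: deconc_wsh_def deconc_eq)
next
  case (2 a u)
  have "(\<Sum>i\<le>n. deconc_wsh i (n - i) (a # u) []) = (\<Sum>i\<in>{n}. deconc_wsh i (n - i) (a # u) [])"
    by (rule sum.mono_neutral_right) (auto simp: deconc_wsh_def)
  then show ?case by (simp add: deconc_wsh_def deconc_eq)
next
  case (3 a u b v)
  show ?case
  proof (cases n)
    case 0
    then show ?thesis by (simp add: deconc_wsh_def tens_lext deconc.simps[abs_def])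
  next
    case (Suc m)
    let ?L = "\<lambda>a. lext (\<lambda>x. wd (a # fst x, snd x))"
    have c: "lext (deconc (Suc m)) (pcons a p) = ?L a (lext (deconc m) p)" for a p
      by (simp add: pcons_def lext_lext)
    have "lext (deconc n) (wsh (a # u) (b # v))
      = ?L a (\<Sum>i\<le>m. deconc_wsh i (m - i) u (b # v)) + ?L b (\<Sum>i\<le>m. deconc_wsh i (m - i) (a # u) v)"
      by (simp add: wsh_Cons lext_add Suc c 3)
    \<comment> \<open>The extreme summands are split off: a prefix taken from one word only obeys
      the one-sided recursions \<open>deconc_wsh_Suc_0\<close> and
      \<open>deconc_wsh_0_Suc\<close>.\<close>
    also have "(\<Sum>i\<le>m. deconc_wsh i (m - i) u (b # v))
        = (\<Sum>i<m. deconc_wsh i (Suc (m - Suc i)) u (b # v)) + deconc_wsh m 0 u (b # v)"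
      by (simp add: lessThan_Suc_atMost[symmetric] Suc_diff_Suc)
    also have "(\<Sum>i\<le>m. deconc_wsh i (m - i) (a # u) v)
        = deconc_wsh 0 m (a # u) v + (\<Sum>i<m. deconc_wsh (Suc i) (m - Suc i) (a # u) v)"
      by (subst sum.atMost_shift) simp
    also have "?L a ((\<Sum>i<m. deconc_wsh i (Suc (m - Suc i)) u (b # v)) + deconc_wsh m 0 u (b # v))
        + ?L b (deconc_wsh 0 m (a # u) v + (\<Sum>i<m. deconc_wsh (Suc i) (m - Suc i) (a # u) v))
      = deconc_wsh 0 (Suc m) (a # u) (b # v)
        + (\<Sum>i<m. deconc_wsh (Suc i) (Suc (m - Suc i)) (a # u) (b # v))
        + deconc_wsh (Suc m) 0 (a # u) (b # v)"
      by (simp add: deconc_wsh_Suc_Suc deconc_wsh_Suc_0 deconc_wsh_0_Suc lext_lin sum.distrib)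
    also have "\<dots> = (\<Sum>i\<le>Suc m. deconc_wsh i (Suc m - i) (a # u) (b # v))"
      by (subst sum.atMost_shift) (simp add: Suc_diff_Suc)
    finally show ?thesis using Suc by simp
  qed
qed

text \<open>The two subtracted terms are the summands in which the prefix comes from one word only.
  In every other summand the left factor is a shuffle of two nonempty words.\<close>

lemma deconc_wsh_mod_ILtens:
  assumes "n \<ge> 1"
  shows "lext (deconc n) (wsh u v) - tmap_right (\<lambda>w. wsh w v) (deconc n u) - tmap_right (\<lambda>w. wsh w
      u) (deconc n v)
     \<in> ILtens n"
proof -
  obtain m where n: "n = Suc m" using assms by (cases n) auto
  have l: "tmap_right (\<lambda>w. wsh w v) (deconc n u) = deconc_wsh n 0 u v"
    by (simp add: deconc_wsh_def deconc_eq tmap_right_lin)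
  have r: "tmap_right (\<lambda>w. wsh w u) (deconc n v) = deconc_wsh 0 n u v"
    by (simp add: deconc_wsh_def deconc_eq tmap_right_lin wsh_commute)
  have "(\<Sum>i\<le>n. deconc_wsh i (n - i) u v)
    = deconc_wsh 0 n u v + (\<Sum>i<m. deconc_wsh (Suc i) (m - i) u v) + deconc_wsh n 0 u v"
    unfolding n by (subst sum.atMost_shift) simp
  then have "lext (deconc n) (wsh u v) - tmap_right (\<lambda>w. wsh w v) (deconc n u) - tmap_right (\<lambda>w.
      wsh w u) (deconc n v)
      = (\<Sum>i<m. deconc_wsh (Suc i) (m - i) u v)"
    by (simp add: lext_deconc_wsh l r)
  also have "\<dots> \<in> ILtens n"
  proof (rule ILtens_sum)
    fix i assume i: "i \<in> {..<m}"
    show "deconc_wsh (Suc i) (m - i) u v \<in> ILtens n"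
    proof (cases "Suc i \<le> length u \<and> m - i \<le> length v")
      case True
      then have "homog n (wsh (take (Suc i) u) (take (m - i) v))"
        using homog_wsh[of "take (Suc i) u" "take (m - i) v"] i True by (simp add: n min_absorb2)
      moreover have "wsh (take (Suc i) u) (take (m - i) v) \<in> ILid"
        using True i by (intro wsh_in_ILid) auto
      ultimately show ?thesis using True by (simp add: deconc_wsh_def tens_in_ILtens)
    qed (auto simp: deconc_wsh_def ILtens_0)
  qed
  finally show ?thesis .
qed

section \<open>Boundary weights and the interval form of \<open>D\<close>\<close>

fun bdry :: "letter \<Rightarrow> rat" where
  "bdry X1 = 1"
| "bdry X0 = 0"

text \<open>Coefficient of an interval at the very start: \<open>c\<close> is the letter before it
  and the head of the remaining word \<open>w\<close> the letter after it, with \<open>X0\<close> as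
  right boundary if nothing remains.\<close>

definition bdry_weight :: "letter \<Rightarrow> word \<Rightarrow> qpoly" where
  "bdry_weight c w = sc (bdry c - bdry (hd (w @ [X0]))) (wd w)"

text \<open>Let \<open>y\<close> be the head of \<open>x\<close>, or \<open>X0\<close> if
  \<open>x\<close> is empty. On the terms of the shuffle that start with \<open>b\<close>, the
  weights \<open>bdry c - bdry b\<close> and \<open>bdry b - bdry y\<close> add up to
  \<open>bdry c - bdry y\<close>, the weight that the other terms carry already.\<close>

lemma bdry_weight_wsh:
  "lext (bdry_weight c) (wsh x (b # v)) + pcons b (lext (\<lambda>w. wsh w v) (bdry_weight b x))
    = lext (\<lambda>w. wsh w (b # v)) (bdry_weight c x)"
proof (cases x)
  case Nil
  then show ?thesis by (simp add: bdry_weight_def lext_lin pcons_def flip: qv.scale_left_distrib)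
next
  case (Cons y t)
  have p: "lext (bdry_weight c) (pcons a p) = sc (bdry c - bdry a) (pcons a p)" for a p
    by (simp add: pcons_def lext_lext bdry_weight_def lext_fun_sc)
  have s: "pcons a (sc k p) = sc k (pcons a p)" for a k p
    by (simp add: pcons_def lext_sc)
  show ?thesis unfolding Cons
    by (simp add: wsh_Cons lext_add p bdry_weight_def[of _ "y # t"] lext_sc s
        qv.scale_right_distrib)
      (simp add: qv.scale_left_diff_distrib)
qed

text \<open>Modulo products the antipode is \<open>-1\<close>, so \<open>I(a; f; b)\<close> becomes \<open>(bdry a - bdry b) f\<close>; the
  letter \<open>c\<close> is the left boundary (\<^term>\<open>X1\<close> for the coaction itself) and \<^term>\<open>X0\<close> the right one.\<close>
definition interval_D :: "nat \<Rightarrow> letter \<Rightarrow> word \<Rightarrow> qtens" where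
  "interval_D n c e = (\<Sum>s<Suc (length e) - n.
     sc (bdry (last (c # take s e)) - bdry (hd (drop (s + n) e @ [X0])))
        (wd (take n (drop s e), take s e @ drop (s + n) e)))"

lemma interval_D_Nil: "n \<ge> 1 \<Longrightarrow> interval_D n c [] = 0"
  by (simp add: interval_D_def)

text \<open>The interval starts either at the first letter or later; in the second case
  \<open>a\<close> takes over as left boundary.\<close>

lemma interval_D_Cons:
  assumes "n \<ge> 1"
  shows "interval_D n c (a # w) = tmap_right (bdry_weight c) (deconc n (a # w)) + tmap_right (\<lambda>w.
      wd (a # w)) (interval_D n a w)"
proof (cases "n \<le> Suc (length w)")
  case True
  then have e: "Suc (length (a # w)) - n = Suc (Suc (length w) - n)" by simp
  show ?thesis
    unfolding interval_D_def e
    by (subst sum.lessThan_Suc_shift)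
      (use True in \<open>simp add: deconc_eq tmap_right_lin bdry_weight_def tens_sc_right\<close>)
next
  case False
  then show ?thesis by (simp add: interval_D_def deconc_eq tmap_right_lin)
qed

text \<open>The boundary contributions of intervals taken from one factor telescope over the letters
  of the other factor; intervals meeting both factors sum up to products.\<close>
theorem interval_D_derivation:
  assumes n: "n \<ge> 1"
  shows "lext (interval_D n c) (wsh u v) - tmap_right (\<lambda>w. wsh w v) (interval_D n c u) -
      tmap_right (\<lambda>w. wsh w u) (interval_D n c v)
     \<in> ILtens n"
proof (induction u v arbitrary: c rule: shl.induct)
  case (1 v)
  have "tmap_right wd T = T" for T
    by (simp add: tmap_right_def lext_wd_id)
  then show ?case by (simp add: interval_D_Nil[OF n] tmap_right_lin ILtens_0)
next
  case (2 a u)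
  have "tmap_right wd T = T" for T
    by (simp add: tmap_right_def lext_wd_id)
  then show ?case by (simp add: interval_D_Nil[OF n] tmap_right_lin ILtens_0)
next
  case (3 a u b v)
  let ?u = "a # u" and ?v = "b # v"
  let ?sh = "\<lambda>v. tmap_right (\<lambda>w. wsh w v)"
  let ?tc = "\<lambda>a. tmap_right (\<lambda>w. wd (a # w))"
  have D: "lext (interval_D n c) (pcons a p) = tmap_right (bdry_weight c) (lext (deconc n) (pcons
      a p))
      + ?tc a (lext (interval_D n a) p)" for a p
    by (simp add: pcons_def lext_lext interval_D_Cons[OF n] lext_fun_add tmap_right_def)
  have L: "lext (interval_D n c) (wsh ?u ?v) = tmap_right (bdry_weight c) (lext (deconc n) (wsh ?u
      ?v))
      + ?tc a (lext (interval_D n a) (wsh u ?v)) + ?tc b (lext (interval_D n b) (wsh ?u v))"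
    by (simp add: wsh_Cons lext_add D tmap_right_lin)
  have sc: "?sh (d # t) (?tc e T) = ?tc e (?sh (d # t) T) + ?tc d (?sh t (?tc e T))" for d e t T
    by (simp add: tmap_right_tmap_right wsh_Cons tmap_right_fun_add pcons_def)
  \<comment> \<open>The telescoping identity \<open>bdry_weight_wsh\<close>, applied in the right
    tensor factor.\<close>
  have om: "tmap_right (bdry_weight c) (?sh (d # t) T) + ?tc d (?sh t (tmap_right (bdry_weight d)
      T))
      = ?sh (d # t) (tmap_right (bdry_weight c) T)" for d t T
    using bdry_weight_wsh[of c _ d t]
    by (simp add: tmap_right_tmap_right pcons_def flip: tmap_right_fun_add)
  \<comment> \<open>\<open>E1\<close> is the defect for initial intervals; \<open>E2\<close> and
    \<open>E3\<close> are the defects of the derivation rule after removing the first letter of one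
    factor. The defect to be bounded is a sum of images of these three under maps of the right
    tensor factor.\<close>
  define E1 where "E1 = lext (deconc n) (wsh ?u ?v) - ?sh ?v (deconc n ?u) - ?sh ?u (deconc n ?v)"
  define E2 where "E2 = lext (interval_D n a) (wsh u ?v) - ?sh ?v (interval_D n a u) - ?sh u
      (interval_D n a ?v)"
  define E3 where "E3 = lext (interval_D n b) (wsh ?u v) - ?sh v (interval_D n b ?u) - ?sh ?u
      (interval_D n b v)"
  have E: "E1 \<in> ILtens n" "E2 \<in> ILtens n" "E3 \<in> ILtens n"
    using deconc_wsh_mod_ILtens[OF n] 3 by (simp_all add: E1_def E2_def E3_def)
  have "lext (interval_D n c) (wsh ?u ?v) - ?sh ?v (interval_D n c ?u) - ?sh ?u (interval_D n c ?v)
     = tmap_right (bdry_weight c) E1 + ?tc a E2 + ?tc b E3"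
  proof -
    have 1: "?sh ?v (interval_D n c ?u) = ?sh ?v (tmap_right (bdry_weight c) (deconc n ?u))
        + ?tc a (?sh ?v (interval_D n a u)) + ?tc b (?sh v (?tc a (interval_D n a u)))"
      by (simp add: interval_D_Cons[OF n, of c] tmap_right_lin sc)
    have 2: "?sh ?u (interval_D n c ?v) = ?sh ?u (tmap_right (bdry_weight c) (deconc n ?v))
        + ?tc b (?sh ?u (interval_D n b v)) + ?tc a (?sh u (?tc b (interval_D n b v)))"
      by (simp add: interval_D_Cons[OF n, of c] tmap_right_lin sc)
    have 3: "?tc a E2 = ?tc a (lext (interval_D n a) (wsh u ?v)) - ?tc a (?sh ?v (interval_D n a u))
        - ?tc a (?sh u (tmap_right (bdry_weight a) (deconc n ?v))) - ?tc a (?sh u (?tc b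
            (interval_D n b v)))"
      by (simp add: E2_def interval_D_Cons[OF n, of a b] tmap_right_lin del: deconc.simps)
    have 4: "?tc b E3 = ?tc b (lext (interval_D n b) (wsh ?u v)) - ?tc b (?sh v (tmap_right
        (bdry_weight b) (deconc n ?u)))
        - ?tc b (?sh v (?tc a (interval_D n a u))) - ?tc b (?sh ?u (interval_D n b v))"
      by (simp add: E3_def interval_D_Cons[OF n, of b a] tmap_right_lin del: deconc.simps)
    have 5: "tmap_right (bdry_weight c) E1 = tmap_right (bdry_weight c) (lext (deconc n) (wsh ?u
        ?v))
        - tmap_right (bdry_weight c) (?sh ?v (deconc n ?u)) - tmap_right (bdry_weight c) (?sh ?u
            (deconc n ?v))"
      by (simp add: E1_def tmap_right_lin)
    show ?thesis
      unfolding 1 2 3 4 5 L om[symmetric] by (simp add: algebra_simps)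
  qed
  also have "\<dots> \<in> ILtens n"
    by (intro ILtens_add tmap_right_ILtens E)
  finally show ?case .
qed

section \<open>Reduction of the coaction to single intervals\<close>

text \<open>The left-hand factors of a summand of the coaction, by recursion over the kept positions
  together with the two boundary positions.\<close>

fun gap_factors :: "word \<Rightarrow> nat list \<Rightarrow> qpoly list" where
  "gap_factors ext (i # j # js) =
     Igon (ext ! i) (take (j - i - 1) (drop (i + 1) ext)) (ext ! j) # gap_factors ext (j # js)"
| "gap_factors ext _ = []"

lemma gap_factors_eq_map:
  "map (\<lambda>p. Igon (ext ! (idx ! p)) (take (idx ! Suc p - idx ! p - 1) (drop (idx ! p + 1) ext))
        (ext ! (idx ! Suc p))) [0..<length idx - 1] = gap_factors ext idx"
proof (induction ext idx rule: gap_factors.induct)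
  case (1 ext i j js)
  have "[0..<length (i # j # js) - 1] = 0 # map Suc [0..<length (j # js) - 1]"
    by (simp add: map_Suc_upt upt_conv_Cons del: upt_Suc)
  then show ?case using 1 by (simp add: comp_def)
qed auto

abbreviation gap_product :: "word \<Rightarrow> nat list \<Rightarrow> qpoly" where
  "gap_product ext idx \<equiv> foldr psh (gap_factors ext idx) (wd [])"

lemma Igon_Nil [simp]: "Igon a [] b = wd []"
  by (simp add: Igon_def antip_def)

lemma homog_Igon: "length f = n \<Longrightarrow> homog n (Igon a f b)"
  by (auto simp: Igon_def antip_def homog_wd intro!: homog_sc)

text \<open>The weight counts the positions between the ends that are not kept. The inequality is
  carried along so that the subtraction of natural numbers is exact.\<close>

lemma homog_gap_product:
  assumes "sorted_wrt (<) (i # js)" "last (i # js) < length ext"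
  shows "homog (last (i # js) - i - length js) (gap_product ext (i # js))
      \<and> i + length js \<le> last (i # js)"
  using assms
proof (induction js arbitrary: i)
  case Nil
  then show ?case by (simp add: homog_wd)
next
  case (Cons j js)
  have IH: "homog (last (j # js) - j - length js) (gap_product ext (j # js))"
    "j + length js \<le> last (j # js)"
    using Cons by auto
  have ij: "i < j" using Cons.prems by simp
  have "homog (j - i - 1) (Igon (ext ! i) (take (j - i - 1) (drop (i + 1) ext)) (ext ! j))"
    using Cons.prems IH(2) ij by (intro homog_Igon) auto
  then have "homog ((j - i - 1) + (last (j # js) - j - length js)) (gap_product ext (i # j # js))"
    using homog_psh[OF _ IH(1)] by simp
  moreover have "(j - i - 1) + (last (j # js) - j - length js)
      = last (i # j # js) - i - length (j # js)"
    using ij IH(2) by auto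
  ultimately show ?case using IH(2) ij by auto
qed

text \<open>Adjacent kept positions enclose an empty gap, whose factor is 1, so a run of consecutive
  positions matters only through its last element.\<close>

lemma gap_product_upt: "i \<le> z \<Longrightarrow> gap_product ext ([i..<z] @ js) = (if i < z \<and> js \<noteq> []
    then gap_product ext ((z - 1) # js) else if js = [] then wd [] else gap_product ext js)"
proof (induction "z - i" arbitrary: i)
  case 0
  then show ?case by simp
next
  case (Suc k)
  then have iz: "i < z" by simp
  show ?case
  proof (cases "Suc i = z")
    case True
    then show ?thesis by (cases js) (auto simp: upt_rec[of i])
  next
    case False
    then have "[i..<z] = i # Suc i # [Suc (Suc i)..<z]" "[Suc i..<z] = Suc i # [Suc (Suc i)..<z]"
      using iz by (auto simp: upt_conv_Cons)
    moreover have "gap_product ext ([Suc i..<z] @ js) =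
        (if Suc i < z \<and> js \<noteq> [] then gap_product ext ((z - 1) # js) else if js = [] then wd []
            else gap_product ext js)"
      using Suc False by (intro Suc(1)) auto
    ultimately show ?thesis using iz False by auto
  qed
qed

lemma gap_product_one_gap:
  assumes "s + n + 1 \<le> z"
  shows "gap_product ext ([0..<Suc s] @ [s + n + 1..<Suc z])
    = Igon (ext ! s) (take n (drop (s + 1) ext)) (ext ! (s + n + 1))"
proof -
  have e: "[s + n + 1..<Suc z] = (s + n + 1) # [s + n + 2..<Suc z]"
    using assms by (simp add: upt_conv_Cons del: upt_Suc)
  have t: "gap_product ext ((s + n + 1) # [s + n + 2..<Suc z]) = wd []"
    using gap_product_upt[of "s + n + 1" "Suc z" ext "[]"] assms e by (simp del: upt_Suc)
  have "gap_product ext ([0..<Suc s] @ [s + n + 1..<Suc z])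
      = gap_product ext (s # [s + n + 1..<Suc z])"
    using gap_product_upt[of 0 "Suc s" ext "[s + n + 1..<Suc z]"] assms
        by (simp del: upt_Suc add: e)
  also have "\<dots> = Igon (ext ! s) (take n (drop (s + 1) ext)) (ext ! (s + n + 1))"
    unfolding e using t by simp
  finally show ?thesis .
qed

lemma strict_sorted_full:
  assumes "sorted_wrt (<) (j # js)" "last (j # js) = j + length js"
  shows "j # js = [j..<Suc (last (j # js))]"
  using assms
proof (induction js arbitrary: j)
  case (Cons k js)
  \<comment> \<open>Only the inequality from \<open>homog_gap_product\<close> is wanted; the word of
    \<open>X0\<close> is a dummy of sufficient length.\<close>
  have "k + length js \<le> last (k # js)"
    using homog_gap_product[of k js "replicate (Suc (last (k # js))) X0"] Cons.prems by auto
  moreover have "j < k" using Cons.prems by simp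
  ultimately have k: "k = Suc j" "last (k # js) = k + length js" using Cons.prems by auto
  obtain z where z: "last (k # js) = z" by blast
  have "k # js = [k..<Suc z]"
    using Cons.IH[of k] Cons.prems k z by (simp del: upt_Suc)
  moreover have "last (j # k # js) = z" using z by simp
  moreover have "[j..<Suc z] = j # [k..<Suc z]"
    using k z by (simp add: upt_rec[of j] del: upt_Suc)
  ultimately show ?case by metis
qed simp

text \<open>If the first gap is empty, pass to the tail. If it is nonempty, either the tail has no
  gap, and this is the only one, or the tail has positive weight, and the whole is a product of two
  elements of positive weight.\<close>

lemma gap_product_ILid:
  assumes "sorted_wrt (<) (i # js)" "last (i # js) < length ext" "last (i # js) = i + length js + n"
    "n \<ge> 1"
  shows "gap_product ext (i # js) \<in> ILid \<or>
    (\<exists>s. i \<le> s \<and> i # js = [i..<Suc s] @ [s + n + 1..<Suc (last (i # js))]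
        \<and> s + n + 1 \<le> last (i # js))"
  using assms
proof (induction js arbitrary: i)
  case Nil
  then show ?case by simp
next
  case (Cons j js)
  have ij: "i < j" using Cons.prems by simp
  have h: "homog (last (j # js) - j - length js) (gap_product ext (j # js))"
    and le: "j + length js \<le> last (j # js)"
    using homog_gap_product[of j js ext] Cons.prems by auto
  show ?case
  proof (cases "j = Suc i")
    case True
    have "gap_product ext (j # js) \<in> ILid \<or>
      (\<exists>s. j \<le> s \<and> j # js = [j..<Suc s] @ [s + n + 1..<Suc (last (j # js))]
          \<and> s + n + 1 \<le> last (j # js))"
      using Cons.prems True by (intro Cons.IH) auto
    then show ?thesis
    proof
      assume "gap_product ext (j # js) \<in> ILid"
      then show ?thesis using True by simp
    next
      assume "\<exists>s. j \<le> s \<and> j # js = [j..<Suc s] @ [s + n + 1..<Suc (last (j # js))]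
          \<and> s + n + 1 \<le> last (j # js)"
      then obtain s where s: "j \<le> s" "j # js = [j..<Suc s] @ [s + n + 1..<Suc (last (j # js))]"
        "s + n + 1 \<le> last (j # js)" by blast
      have "[i..<Suc s] = i # [j..<Suc s]"
        using s(1) True by (simp add: upt_rec[of i] del: upt_Suc)
      moreover have l: "last (i # j # js) = last (j # js)" by simp
      ultimately have "i # j # js = [i..<Suc s] @ [s + n + 1..<Suc (last (i # j # js))]"
        using s(2) by (metis append_Cons)
      moreover have "i \<le> s" using s(1) True by simp
      ultimately show ?thesis using s(3) l by metis
    qed
  next
    case False
    have h1: "homog (j - i - 1) (Igon (ext ! i) (take (j - i - 1) (drop (i + 1) ext)) (ext ! j))"
      using Cons.prems le ij by (intro homog_Igon) auto
    show ?thesis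
    proof (cases "last (j # js) = j + length js")
      case True
      have "j # js = [j..<Suc (last (j # js))]"
        using strict_sorted_full[of j js] True Cons.prems by auto
      moreover have "j = i + n + 1" using True Cons.prems by simp
      moreover have "last (i # j # js) = last (j # js)" "[i..<Suc i] = [i]" by auto
      ultimately have "i # j # js = [i..<Suc i] @ [i + n + 1..<Suc (last (i # j # js))]"
        by (metis append_Cons append_Nil)
      moreover have "i + n + 1 \<le> last (i # j # js)"
        using \<open>j = i + n + 1\<close> le by auto
      ultimately show ?thesis by blast
    next
      case f: False
      have "psh (Igon (ext ! i) (take (j - i - 1) (drop (i + 1) ext)) (ext ! j)) (gap_product ext
          (j # js)) \<in> ILid"
        using homog_const[OF h1] homog_const[OF h] False ij f le by (intro psh_in_ILid) auto
      then show ?thesis by simp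
    qed
  qed
qed

lemma projL_tens_homog: "homog n p \<Longrightarrow> projL m (tens p q) = (if m = n then tens p q else 0)"
proof -
  assume "homog n p"
  then have "tens p q = (\<Sum>u\<in>Poly_Mapping.keys p. \<Sum>v\<in>Poly_Mapping.keys q.
      sc (Poly_Mapping.lookup p u * Poly_Mapping.lookup q v) (wd (u, v)))"
    and l: "\<And>u. u \<in> Poly_Mapping.keys p \<Longrightarrow> length u = n"
    by (auto simp: tens_def homog_def)
  then show ?thesis
    by (auto simp: projL_lext lext_sum lext_sc intro!: sum.cong sum.neutral)
qed

lemma Igon_ILid:
  assumes "f \<noteq> []"
  shows "Igon a f b - sc (bdry a - bdry b) (wd f) \<in> ILid"
proof -
  have 0: "0 \<in> ILid" by (rule qv.subspace_0[OF subspace_ILid])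
  show ?thesis
    using antip_ILid[OF assms] 0 assms by (cases a; cases b) (auto simp: Igon_def)
qed

lemma map_nth_upt: "t \<le> length xs \<Longrightarrow> map ((!) xs) [s..<t] = drop s (take t xs)"
  by (rule nth_equalityI) auto

text \<open>The projection keeps the summands that remove exactly \<open>n\<close> positions.
  Several nonempty gaps give products. A single gap starting after position \<open>s\<close> is the
  index set \<open>Good s\<close>, and there \<open>Igon_ILid\<close> replaces \<open>Igon\<close>
  by its boundary weight.\<close>

lemma Drep_wd_interval_D:
  assumes n: "n \<ge> 1"
  shows "Drep n (wd e) - interval_D n X1 e \<in> ILtens n"
proof -
  let ?m = "length e" and ?ext = "X1 # e @ [X0]"
  define idx where "idx S = 0 # sorted_list_of_set S @ [?m + 1]" for S :: "nat set"
  define summand where "summand S = projL n (tens (gap_product ?ext (idx S))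
      (wd (map ((!) ?ext) (sorted_list_of_set S))))" for S
  \<comment> \<open>The kept positions when exactly the letters at \<open>s + 1\<close> to
    \<open>s + n\<close> are cut out.\<close>
  define Good where "Good s = {1..s} \<union> {s + n + 1..?m}" for s
  define G where "G = Good ` {..<Suc ?m - n}"
  have "gon_word e = (\<Sum>S\<in>Pow {1..?m}. tens (gap_product ?ext (idx S))
      (wd (map ((!) ?ext) (sorted_list_of_set S))))"
    unfolding gon_word_def Let_def
  proof (rule sum.cong[OF refl])
    fix S assume "S \<in> Pow {1..length e}"
    then have f: "finite S" by (auto intro: finite_subset)
    have "[0..<card S + 1] = [0..<length (idx S) - 1]" using f by (simp add: idx_def)
    then show "tens (foldr psh (map (\<lambda>p. Igon (?ext ! ((0 # sorted_list_of_set S @ [length e + 1])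
        ! p))
          (take ((0 # sorted_list_of_set S @ [length e + 1]) ! Suc p - (0 # sorted_list_of_set S @
              [length e + 1]) ! p - 1)
             (drop ((0 # sorted_list_of_set S @ [length e + 1]) ! p + 1) ?ext))
          (?ext ! ((0 # sorted_list_of_set S @ [length e + 1]) ! Suc p))) [0..<card S + 1]) (wd []))
        (wd (map ((!) ?ext) (sorted_list_of_set S)))
      = tens (gap_product ?ext (idx S)) (wd (map ((!) ?ext) (sorted_list_of_set S)))"
      by (simp only: idx_def[symmetric] gap_factors_eq_map)
  qed
  moreover have "projL n (tens (wd []) (wd e)) = 0"
    using n by (subst projL_tens_homog[of 0]) (auto simp: homog_wd)
  ultimately have "Drep n (wd e) = projL n (\<Sum>S\<in>Pow {1..?m}.
      tens (gap_product ?ext (idx S)) (wd (map ((!) ?ext) (sorted_list_of_set S))))"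
    unfolding Drep_def gon_lext by (simp add: projL_lext lext_diff)
  also have "\<dots> = (\<Sum>S\<in>Pow {1..?m}. summand S)"
    unfolding summand_def projL_lext lext_sum ..
  finally have D: "Drep n (wd e) = (\<Sum>S\<in>Pow {1..?m}. summand S)" .
  have fin: "finite S" if "S \<in> Pow {1..?m}" for S
    using that by (auto intro: finite_subset)
  have sorted: "sorted_wrt (<) (idx S)" if "S \<in> Pow {1..?m}" for S
    using that fin[OF that] by (auto simp: idx_def sorted_wrt_append)
  have hom: "homog (?m - card S) (gap_product ?ext (idx S))" if "S \<in> Pow {1..?m}" for S
    using homog_gap_product[OF sorted[OF that, unfolded idx_def], of ?ext] by (simp add: idx_def)
  have bad: "summand S \<in> ILtens n" if S: "S \<in> Pow {1..?m} - G" for S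
  proof (cases "n = ?m - card S")
    case False
    then show ?thesis using S hom[of S] by (simp add: summand_def projL_tens_homog ILtens_0)
  next
    case True
    have "card S \<le> ?m" using S card_mono[of "{1..?m}" S] by auto
    then have "gap_product ?ext (idx S) \<in> ILid \<or> (\<exists>s. 0 \<le> s \<and> idx S
        = [0..<Suc s] @ [s + n + 1..<Suc (last (idx S))] \<and> s + n + 1 \<le> last (idx S))"
      unfolding idx_def using S True n sorted[of S] by (intro gap_product_ILid) (auto simp: idx_def)
    then show ?thesis
    proof
      assume "gap_product ?ext (idx S) \<in> ILid"
      then show ?thesis using S hom[of S] True by (auto simp: summand_def projL_tens_homog intro:
          tens_in_ILtens)
    next
      assume "\<exists>s. 0 \<le> s \<and> idx S = [0..<Suc s] @ [s + n + 1..<Suc (last (idx S))]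
          \<and> s + n + 1 \<le> last (idx S)"
      then obtain s where s: "idx S = [0..<Suc s] @ [s + n + 1..<Suc (?m + 1)]" "s + n \<le> ?m"
        by (auto simp: idx_def)
      \<comment> \<open>The lists include the boundary positions; deleting these two from both sides
        recovers \<open>S\<close>.\<close>
      have "insert 0 (insert (?m + 1) S) = {0..<Suc s} \<union> {s + n + 1..<Suc (?m + 1)}"
        using arg_cong[OF s(1), of set] fin[of S] S by (auto simp: idx_def simp del: upt_Suc)
      moreover have "0 \<notin> S" "?m + 1 \<notin> S" using S by auto
      ultimately have "S = ({0..<Suc s} \<union> {s + n + 1..<Suc (?m + 1)}) - {0, ?m + 1}" by blast
      also have "\<dots> = Good s" using s(2) n by (auto simp: Good_def)
      finally have "S \<in> G" using s(2) by (auto simp: G_def)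
      then show ?thesis using S by simp
    qed
  qed
  have inj: "inj_on Good {..<Suc ?m - n}"
  proof (rule linorder_inj_onI')
    fix s t assume st: "s \<in> {..<Suc ?m - n}" "t \<in> {..<Suc ?m - n}" "s < t"
    then have "Suc s \<in> Good t" "Suc s \<notin> Good s" using n by (auto simp: Good_def)
    then show "Good s \<noteq> Good t" by blast
  qed
  have GP: "G \<subseteq> Pow {1..?m}" by (auto simp: G_def Good_def)
  have good: "summand (Good s) = tens (Igon (last (X1 # take s e))
      (take n (drop s e)) (hd (drop (s + n) e @ [X0])))
       (wd (take s e @ drop (s + n) e))"
    if s: "s < Suc ?m - n" for s
  proof -
    have l: "sorted_list_of_set (Good s) = [1..<Suc s] @ [s + n + 1..<Suc ?m]"
    proof (rule sorted_distinct_set_unique)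
      show "set (sorted_list_of_set (Good s)) = set ([1..<Suc s] @ [s + n + 1..<Suc ?m])"
        using s by (auto simp: Good_def simp del: upt_Suc)
    qed (use s in \<open>auto simp: sorted_append simp del: upt_Suc\<close>)
    have i: "idx (Good s) = [0..<Suc s] @ [s + n + 1..<Suc (?m + 1)]"
      using s by (simp add: idx_def l upt_rec[of 0] del: upt_Suc) (subst upt_Suc, simp)
    have w: "map ((!) ?ext) (sorted_list_of_set (Good s)) = take s e @ drop (s + n) e"
      using s by (simp add: l map_nth_upt del: upt_Suc)
    have a: "?ext ! s = last (X1 # take s e)"
      using s n by (cases s) (auto simp: nth_append last_conv_nth min_def)
    have b: "?ext ! (s + n + 1) = hd (drop (s + n) e @ [X0])"
      using s by (auto simp: nth_append hd_append hd_drop_conv_nth)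
    have f: "take n (drop (s + 1) ?ext) = take n (drop s e)"
      using s by simp
    have "gap_product ?ext (idx (Good s)) = Igon (last (X1 # take s e))
        (take n (drop s e)) (hd (drop (s + n) e @ [X0]))"
      unfolding i using gap_product_one_gap[of s n "?m + 1" ?ext] s by (simp only: a b f)
    moreover have "homog n \<dots>" using s by (intro homog_Igon) simp
    ultimately show ?thesis by (simp add: summand_def w projL_tens_homog)
  qed
  have "Drep n (wd e) = (\<Sum>S\<in>Pow {1..?m} - G. summand S) + (\<Sum>S\<in>G. summand S)"
    unfolding D using GP by (subst sum.subset_diff[of G]) auto
  also have "(\<Sum>S\<in>G. summand S) = (\<Sum>s<Suc ?m - n. summand (Good s))"
    unfolding G_def by (subst sum.reindex[OF inj]) simp
  finally have "Drep n (wd e) - interval_D n X1 e = (\<Sum>S\<in>Pow {1..?m} - G. summand S)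
     + (\<Sum>s<Suc ?m - n. summand (Good s) - sc (bdry (last (X1 # take s e)) - bdry (hd (drop (s + n)
         e @ [X0])))
        (wd (take n (drop s e), take s e @ drop (s + n) e)))"
    by (simp add: interval_D_def sum_subtractf)
  also have "\<dots> \<in> ILtens n"
  proof (intro ILtens_add ILtens_sum bad)
    fix s assume "s \<in> {..<Suc ?m - n}"
    then have s: "s < Suc ?m - n" by simp
    let ?a = "last (X1 # take s e)" and ?b = "hd (drop (s + n) e @ [X0])" and ?f
        = "take n (drop s e)"
    let ?w = "take s e @ drop (s + n) e"
    have "?f \<noteq> []" using s n by auto
    then have "tens (Igon ?a ?f ?b - sc (bdry ?a - bdry ?b) (wd ?f)) (wd ?w) \<in> ILtens n"
      using s by (intro tens_in_ILtens Igon_ILid homog_diff homog_Igon homog_sc) (auto simp: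
          homog_wd)
    then show "summand (Good s) - sc (bdry ?a - bdry ?b) (wd (?f, ?w)) \<in> ILtens n"
      unfolding good[OF s] by (simp only: tens_diff_left tens_sc_left tens_wd)
  qed
  finally show ?thesis .
qed

lemma Drep_lext: "Drep n p = lext (\<lambda>w. Drep n (wd w)) p"
  by (simp add: Drep_def projL_lext gon_lext tens_lext lext_lext lext_diff lext_fun_diff)

lemma Drep_lin:
  "Drep n (p + q) = Drep n p + Drep n q"
  "Drep n (p - q) = Drep n p - Drep n q"
  "Drep n (sc c p) = sc c (Drep n p)"
  "Drep n (\<Sum>i\<in>A. g i) = (\<Sum>i\<in>A. Drep n (g i))"
  "Drep n 0 = 0"
  using lext_lin[of "\<lambda>w. Drep n (wd w)"] lext_0[of "\<lambda>w. Drep n (wd w)"]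
  by (auto simp flip: Drep_lext)

lemma Drep_interval_D: "n \<ge> 1 \<Longrightarrow> Drep n p - lext (interval_D n X1) p \<in> ILtens n"
  unfolding Drep_lext[of n p] lext_fun_diff[symmetric]
  by (rule lext_in_subspace) (auto intro: Drep_wd_interval_D)

section \<open>Words in the letters 2 and 3\<close>

text \<open>With a leading \<open>X1\<close> and two trailing \<open>X0\<close>, this condition
  characterises the words \<open>iota ks\<close> with entries 2 and 3. Being local, it can be
  checked at the seam of a cut.\<close>

fun no_11_000 :: "word \<Rightarrow> bool" where
  "no_11_000 (x # y # z # w) \<longleftrightarrow>
     \<not> (x = X1 \<and> y = X1) \<and> \<not> (x = X0 \<and> y = X0 \<and> z = X0) \<and> no_11_000 (y # z # w)"
| "no_11_000 [x, y] \<longleftrightarrow> \<not> (x = X1 \<and> y = X1)"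
| "no_11_000 [x] \<longleftrightarrow> True"
| "no_11_000 [] \<longleftrightarrow> True"

lemma no_11_000_tl: "no_11_000 (x # w) \<Longrightarrow> no_11_000 w"
  by (cases "x # w" rule: no_11_000.cases) auto

lemma no_11_000_appendD2: "no_11_000 (p @ q) \<Longrightarrow> no_11_000 q"
  by (induction p) (auto dest: no_11_000_tl)

lemma no_11_000_appendD1: "no_11_000 (p @ q) \<Longrightarrow> no_11_000 p"
proof (induction p rule: no_11_000.induct)
  case (2 x y)
  then show ?case by (cases q) auto
qed auto

text \<open>A forbidden factor crossing the seam would contain both \<open>a\<close> and
  \<open>b\<close>, but forbidden factors consist of equal letters.\<close>

lemma no_11_000_join: "no_11_000 (p @ [a]) \<Longrightarrow> no_11_000 (b # s) \<Longrightarrow> a \<noteq> b \<Longrightarrow> no_11_000 (p @ a # b # s)"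
proof (induction p rule: no_11_000.induct)
  case (2 x y)
  then show ?case by (cases a; cases b; cases x; cases y; cases s) auto
next
  case (3 x)
  then show ?case by (cases a; cases b; cases x; cases s) auto
next
  case 4
  then show ?case by (cases a; cases b; cases s) auto
qed auto

lemma no_11_000_successively: "no_11_000 w \<Longrightarrow> successively (\<lambda>x y. \<not> (x = X1 \<and> y = X1)) w"
  by (induction w rule: no_11_000.induct) auto

lemma iota_simps: "iota [] = []" "iota (k # ks) = replicate (k - 1) X0 @ X1 # iota ks"
  by (simp_all add: iota_def)

lemma iota_append: "iota (ks @ ls) = iota ks @ iota ls"
  by (simp add: iota_def)

lemma iota_23: "iota (2 # ks) = X0 # X1 # iota ks" "iota (3 # ks) = X0 # X0 # X1 # iota ks"
  by (simp_all add: iota_simps numeral_eq_Suc)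

lemma no_11_000_iota: "set ks \<subseteq> {2, 3} \<Longrightarrow> no_11_000 (X1 # iota ks @ [X0, X0])"
proof (induction ks)
  case (Cons k ks)
  then show ?case by (cases "iota ks") (auto simp: iota_23)
qed (simp add: iota_simps)

text \<open>The two trailing letters \<^term>\<open>X0\<close> force a nonempty word to end in \<^term>\<open>X1\<close>.\<close>
lemma no_11_000_imp_iota: "no_11_000 (X1 # e @ [X0, X0]) \<Longrightarrow> \<exists>ks. set ks \<subseteq> {2, 3} \<and> e = iota ks"
proof (induction "length e" arbitrary: e rule: less_induct)
  case less
  show ?case
  proof (cases e)
    case Nil
    then show ?thesis by (intro exI[of _ "[]"]) (simp add: iota_simps)
  next
    case (Cons x e1)
    then have x: "x = X0" using less.prems by (cases x; cases e1) auto
    show ?thesis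
    proof (cases e1)
      case Nil
      then show ?thesis using less.prems Cons x by simp
    next
      case e1: (Cons y e2)
      show ?thesis
      proof (cases y)
        case X1
        have "no_11_000 (X1 # e2 @ [X0, X0])"
          using less.prems Cons e1 x X1 no_11_000_appendD2[of "[X1, X0]" "X1 # e2 @ [X0, X0]"] by
              simp
        then obtain ks where "set ks \<subseteq> {2, 3}" "e2 = iota ks"
          using less.hyps[of e2] Cons e1 by auto
        then show ?thesis using Cons e1 x X1 by (intro exI[of _ "2 # ks"]) (simp add: iota_23)
      next
        case X0
        show ?thesis
        proof (cases e2)
          case Nil
          then show ?thesis using less.prems Cons e1 x X0 by simp
        next
          case e2: (Cons z e3)
          then have z: "z = X1" using less.prems Cons e1 x X0 by (cases z) auto
          have "no_11_000 (X1 # e3 @ [X0, X0])"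
            using less.prems Cons e1 x X0 e2 z no_11_000_appendD2[of "[X1, X0, X0]" "X1 # e3 @
                [X0, X0]"]
            by simp
          then obtain ks where "set ks \<subseteq> {2, 3}" "e3 = iota ks"
            using less.hyps[of e3] Cons e1 e2 by auto
          then show ?thesis using Cons e1 x X0 e2 z
            by (intro exI[of _ "3 # ks"]) (simp add: iota_23)
        qed
      qed
    qed
  qed
qed

lemma length_iota: "0 \<notin> set ks \<Longrightarrow> length (iota ks) = sum_list ks"
  by (induction ks) (auto simp: iota_simps)

text \<open>Each entry contributes one \<open>X1\<close>, and a 3 one letter more than a 2. The
  number of 3's can thus be computed from quantities additive under cutting.\<close>

lemma length_iota_23:
  "set ks \<subseteq> {2, 3} \<Longrightarrow> length (iota ks) = 2 * count_list (iota ks) X1 + count_list ks 3"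
  by (induction ks) (auto simp: iota_23 iota_simps(1))

definition alt01 :: "nat \<Rightarrow> word" where
  "alt01 k = iota (replicate k 2)"

lemma alt01_simps [simp]: "alt01 0 = []" "alt01 (Suc k) = X0 # X1 # alt01 k"
  by (simp_all add: alt01_def iota_23 iota_simps)

lemma length_alt01 [simp]: "length (alt01 k) = 2 * k"
  by (induction k) auto

text \<open>Each \<open>X1\<close> in \<open>f\<close> has an \<open>X0\<close> of \<open>f\<close>
  directly before it, so \<open>f\<close> consists of blocks \<open>X0 X1\<close> and single letters
  \<open>X0\<close>; the excess of the length over \<open>2 * count_list f X1\<close> is the number
  of single letters.\<close>

lemma word_01_blocks:
  assumes "successively (\<lambda>x y. \<not> (x = X1 \<and> y = X1)) (X1 # f @ [X0])"
  shows "2 * count_list f X1 \<le> length f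
    \<and> (length f = 2 * count_list f X1 \<longrightarrow> (\<exists>k. f = alt01 k))
    \<and> (length f = 2 * count_list f X1 + 1 \<longrightarrow> (\<exists>i j. f = alt01 i @ X0 # alt01 j))"
  using assms
proof (induction "length f" arbitrary: f rule: less_induct)
  case less
  show ?case
  proof (cases f)
    case Nil
    then show ?thesis by (auto intro: exI[of _ 0])
  next
    case (Cons x g)
    then have x: "x = X0" using less.prems by (cases x) auto
    show ?thesis
    proof (cases "\<exists>g'. g = X1 # g'")
      case True
      then obtain g' where g: "g = X1 # g'" by blast
      have IH: "2 * count_list g' X1 \<le> length g'
        \<and> (length g' = 2 * count_list g' X1 \<longrightarrow> (\<exists>k. g' = alt01 k))
        \<and> (length g' = 2 * count_list g' X1 + 1 \<longrightarrow> (\<exists>i j. g' = alt01 i @ X0 # alt01 j))"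
        using less.prems by (intro less.hyps) (simp_all add: Cons g x)
      have "\<exists>k. f = alt01 k" if "\<exists>k. g' = alt01 k"
        using that Cons g x alt01_simps(2) by metis
      moreover have "\<exists>i j. f = alt01 i @ X0 # alt01 j" if "\<exists>i j. g' = alt01 i @ X0 # alt01 j"
        using that Cons g x alt01_simps(2) append_Cons by metis
      ultimately show ?thesis using IH by (auto simp: Cons g x)
    next
      case False
      \<comment> \<open>The letter after the stripped \<open>X0\<close> is not \<open>X1\<close>, so
        the padding \<open>X1\<close> may take the place of that \<open>X0\<close>.\<close>
      then have "successively (\<lambda>x y. \<not> (x = X1 \<and> y = X1)) (X1 # g @ [X0])"
        using less.prems by (cases g) (auto simp: Cons x)
      then have IH: "2 * count_list g X1 \<le> length g
        \<and> (length g = 2 * count_list g X1 \<longrightarrow> (\<exists>k. g = alt01 k))"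
        using less.hyps[of g] Cons by auto
      have "\<exists>i j. f = alt01 i @ X0 # alt01 j" if "\<exists>k. g = alt01 k"
        using that Cons x alt01_simps(1) append_Nil by metis
      then show ?thesis using IH by (auto simp: Cons x)
    qed
  qed
qed

lemma cut_23_word:
  assumes ks: "set ks \<subseteq> {2, 3}" and e: "iota ks = u @ f @ v" and n: "odd (length f)"
    and ab: "last (X1 # u) \<noteq> hd (v @ [X0])"
  obtains ks' where "set ks' \<subseteq> {2, 3}" "u @ v = iota ks'" "sum_list ks' + length f = sum_list ks"
    "count_list ks' 3 + 1 = count_list ks 3 \<and> (\<exists>i j. f = alt01 i @ X0 # alt01 j \<or> rev f
        = alt01 i @ X0 # alt01 j)
      \<or> count_list ks' 3 + 2 \<le> count_list ks 3"
proof -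
  \<comment> \<open>The neighbours of \<open>f\<close> in the padded word; the padding supplies them
    if \<open>u\<close> or \<open>v\<close> is empty.\<close>
  define a b where "a = last (X1 # u)" and "b = hd (v @ [X0])"
  obtain p where p: "X1 # u = p @ [a]"
    by (metis a_def append_butlast_last_id list.discI)
  obtain q where q: "v @ [X0, X0] = b # q"
    unfolding b_def by (cases v) auto
  have "no_11_000 (p @ [a] @ f @ [b] @ q)"
    using no_11_000_iota[OF ks] e p q
    by (metis append.assoc append_Cons append_Nil)
  then have nf: "no_11_000 (p @ [a])" "no_11_000 (a # f @ [b])" "no_11_000 (b # q)"
    using no_11_000_appendD1[of "p @ [a]" "f @ [b] @ q"] no_11_000_appendD2[of p "a # f @ b # q"]
      no_11_000_appendD1[of "a # f @ [b]" q] no_11_000_appendD2[of "p @ [a] @ f" "b # q"] by auto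
  \<comment> \<open>The padding sits in \<open>p @ [a]\<close> and \<open>b # q\<close>, so after
    the cut the joined word is \<open>u @ v\<close> with the same padding.\<close>
  have "no_11_000 (p @ a # b # q)" using nf ab by (intro no_11_000_join) (auto simp: a_def b_def)
  then have "no_11_000 (X1 # (u @ v) @ [X0, X0])"
    using p q by (metis append.assoc append_Cons append_Nil)
  then obtain ks' where ks': "set ks' \<subseteq> {2, 3}" "u @ v = iota ks'"
    using no_11_000_imp_iota by blast
  have s: "sum_list ks' + length f = sum_list ks"
  proof -
    have "0 \<notin> set ks" "0 \<notin> set ks'" using ks ks' by auto
    then have "sum_list ks = length (iota ks)" "sum_list ks' = length (iota ks')"
      by (simp_all add: length_iota)
    then show ?thesis by (simp add: e flip: ks'(2))
  qed
  \<comment> \<open>The drop in the number of 3's is therefore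
    \<open>length f - 2 * count_list f X1\<close>.\<close>
  have c: "length f + 2 * count_list (u @ v) X1 + count_list ks' 3
     = 2 * count_list (u @ f @ v) X1 + count_list ks 3"
    using length_iota_23[OF ks] length_iota_23[OF ks'(1)] by (simp add: e flip: ks'(2))
  have sc: "successively (\<lambda>x y. \<not> (x = X1 \<and> y = X1)) (a # f @ [b])"
    using nf(2) by (rule no_11_000_successively)
  have "2 * count_list f X1 \<le> length f \<and> (length f = 2 * count_list f X1 + 1 \<longrightarrow>
      (\<exists>i j. f = alt01 i @ X0 # alt01 j \<or> rev f = alt01 i @ X0 # alt01 j))"
  proof (cases a)
    case X1
    then have "b = X0" using ab by (cases b) (auto simp: a_def b_def)
    then show ?thesis using word_01_blocks[of f] sc X1 by auto
  next
    case X0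
    then have b: "b = X1" using ab by (cases b) (auto simp: a_def b_def)
    \<comment> \<open>Reversal exchanges the neighbours and brings this case into the form required
      by \<open>word_01_blocks\<close>.\<close>
    have "successively (\<lambda>x y. \<not> (x = X1 \<and> y = X1)) (rev (a # f @ [b]))"
      using sc unfolding successively_rev by (simp add: conj_commute)
    then show ?thesis using word_01_blocks[of "rev f"] X0 b by auto
  qed
  moreover have "length f \<noteq> 2 * count_list f X1" using n by auto
  ultimately have "count_list ks' 3 + 1 = count_list ks 3 \<and> (\<exists>i j. f = alt01 i @ X0 # alt01 j
      \<or> rev f = alt01 i @ X0 # alt01 j)
      \<or> count_list ks' 3 + 2 \<le> count_list ks 3"
    using c by (cases "length f = 2 * count_list f X1 + 1") auto
  then show ?thesis using that ks' s by blast
qed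

section \<open>The line of \<open>zeta(n)\<close> modulo products, and the intervals of words of 2's
  and 3's\<close>

definition zeta_line :: "nat \<Rightarrow> qpoly set" where
  "zeta_line n = qv.span (insert (wd (zw n)) ILid)"

lemma zeta_line_iff: "p \<in> zeta_line n \<longleftrightarrow> (\<exists>c. p - sc c (wd (zw n)) \<in> ILid)"
  unfolding zeta_line_def qv.span_insert by (simp add: qv.span_eq_iff[THEN iffD2, OF subspace_ILid])

lemma subspace_zeta_line: "qv.subspace (zeta_line n)"
  by (simp add: zeta_line_def)

lemma ILid_subset_zeta_line: "p \<in> ILid \<Longrightarrow> p \<in> zeta_line n"
  by (simp add: zeta_line_def qv.span_base)

text \<open>In odd length the sign of the antipode is -1, so by \<open>antip_ILid\<close> a word and
  its reversal agree modulo \<open>ILid\<close>.\<close>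

lemma rev_in_zeta_line:
  assumes "odd (length f)" "wd (rev f) \<in> zeta_line n"
  shows "wd f \<in> zeta_line n"
proof -
  have "wd f = (antip f + wd f) + wd (rev f)"
    using assms(1) by (simp add: antip_def)
  moreover have "antip f + wd f \<in> zeta_line n"
    using assms(1) by (intro ILid_subset_zeta_line antip_ILid) auto
  ultimately show ?thesis
    using assms(2) qv.subspace_add[OF subspace_zeta_line] by metis
qed

text \<open>Equal neighbours give coefficient 0. Otherwise \<open>cut_23_word\<close> applies, and
  when just one 3 is lost \<open>Sp\<close> turns the cut-out word into a multiple of
  \<open>zeta(n)\<close>. \<open>Sp\<close> is a hypothesis because it is supplied first by an
  induction on the weight and later in general.\<close>

lemma interval_D_23_word:
  fixes r :: nat
  defines "n \<equiv> 2 * r + 1"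
  assumes ks: "set ks \<subseteq> {2, 3}"
    and Sp: "\<And>i j. i + j = r \<Longrightarrow> wd (alt01 i @ X0 # alt01 j) \<in> zeta_line n"
  shows "interval_D n X1 (iota ks) \<in> qv.span (ILtens n
    \<union> {wd (zw n, iota ks') | ks'. set ks' \<subseteq> {2, 3} \<and> sum_list ks' + n = sum_list ks
          \<and> count_list ks' 3 + 1 = count_list ks 3}
    \<union> {wd (f, iota ks') | f ks'. length f = n \<and> set ks' \<subseteq> {2, 3}
          \<and> count_list ks' 3 + 2 \<le> count_list ks 3})" (is "_ \<in> qv.span (_ \<union> ?A \<union> ?B)")
  unfolding interval_D_def
proof (rule qv.span_sum)
  fix s assume "s \<in> {..<Suc (length (iota ks)) - n}"
  then have s: "s + n \<le> length (iota ks)" by auto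
  define u f v where "u = take s (iota ks)" and "f = take n (drop s (iota ks))"
    and "v = drop (s + n) (iota ks)"
  have e: "iota ks = u @ f @ v"
    by (simp add: u_def f_def v_def) (metis append_take_drop_id drop_drop add.commute)
  have lf: "length f = n" using s by (simp add: f_def)
  let ?V = "qv.span (ILtens n \<union> ?A \<union> ?B)"
  have "sc (bdry (last (X1 # u)) - bdry (hd (v @ [X0]))) (wd (f, u @ v)) \<in> ?V"
  proof (cases "last (X1 # u) = hd (v @ [X0])")
    case True
    then show ?thesis by (simp add: qv.span_zero)
  next
    case False
    have odd: "odd (length f)" by (simp add: lf n_def)
    obtain ks' where ks': "set ks' \<subseteq> {2, 3}" "u @ v = iota ks'" "sum_list ks' + length f
        = sum_list ks"
      and alt: "count_list ks' 3 + 1 = count_list ks 3 \<and> (\<exists>i j. f = alt01 i @ X0 # alt01 j \<or> rev f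
          = alt01 i @ X0 # alt01 j)
      \<or> count_list ks' 3 + 2 \<le> count_list ks 3"
      using cut_23_word[OF ks e odd False] by blast
    from alt have "wd (f, u @ v) \<in> ?V"
    proof
      assume "count_list ks' 3 + 2 \<le> count_list ks 3"
      then have "wd (f, u @ v) \<in> ?B" using ks' lf by auto
      then show ?thesis by (intro qv.span_base) blast
    next
      assume *: "count_list ks' 3 + 1 = count_list ks 3 \<and> (\<exists>i j. f = alt01 i @ X0 # alt01 j
          \<or> rev f = alt01 i @ X0 # alt01 j)"
      then obtain i j where ij: "f = alt01 i @ X0 # alt01 j \<or> rev f
          = alt01 i @ X0 # alt01 j" by blast
      then have "length f = 2 * (i + j) + 1" by (metis add_Suc_right length_append length_Cons
          length_rev length_alt01 add_mult_distrib2 Suc_eq_plus1)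
      then have "i + j = r" using lf by (simp add: n_def)
      then have "wd f \<in> zeta_line n" using ij Sp[of i j] rev_in_zeta_line[OF odd, of n] by metis
      then obtain c where c: "wd f - sc c (wd (zw n)) \<in> ILid" unfolding zeta_line_iff by blast
      have "homog n (wd f - sc c (wd (zw n)))"
        using lf by (intro homog_diff homog_sc) (auto simp: homog_wd zw_def iota_simps n_def)
      then have "tens (wd f - sc c (wd (zw n))) (wd (u @ v)) \<in> ILtens n"
        using c by (rule tens_in_ILtens)
      then have 1: "wd (f, u @ v) - sc c (wd (zw n, u @ v)) \<in> ?V"
        by (intro qv.span_base) (simp add: tens_diff_left tens_sc_left)
      have "wd (zw n, u @ v) \<in> ?A" using * ks' lf by auto
      then have "sc c (wd (zw n, u @ v)) \<in> ?V" by (intro qv.span_scale qv.span_base) blast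
      from qv.span_add[OF 1 this] show ?thesis by (simp only: diff_add_cancel)
    qed
    then show ?thesis by (rule qv.span_scale)
  qed
  then show "sc (bdry (last (X1 # take s (iota ks))) - bdry (hd (drop (s + n) (iota ks) @ [X0])))
        (wd (take n (drop s (iota ks)), take s (iota ks) @ drop (s + n) (iota ks))) \<in> ?V"
    by (simp add: u_def f_def v_def)
qed

section \<open>Words with a single 3\<close>

text \<open>Divide \<open>x0 sh x0^m = (m + 1) x0^(m + 1)\<close> by \<open>m + 1\<close>, for
  positive \<open>m = n - 1\<close>.\<close>

lemma replicate_X0_ILid:
  assumes "n \<ge> 2"
  shows "wd (replicate n X0) \<in> ILid"
proof -
  have *: "wsh [X0] (replicate m X0) = sc (of_nat m + 1) (wd (replicate (Suc m) X0))" for m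
  proof (induction m)
    case (Suc m)
    have "wsh [X0] (replicate (Suc m) X0) = wd (replicate (Suc (Suc m)) X0)
       + pcons X0 (sc (of_nat m + 1) (wd (replicate (Suc m) X0)))"
      unfolding Suc.IH[symmetric] by (simp add: wsh_Cons)
    also have "\<dots> = sc (1 + (of_nat m + 1)) (wd (replicate (Suc (Suc m)) X0))"
      unfolding qv.scale_left_distrib by (simp add: pcons_def lext_sc lext_add)
    finally show ?case by (simp add: add_ac)
  qed simp
  obtain m where m: "n = Suc m" "m \<noteq> 0" using assms by (cases n) auto
  have "sc (inverse (of_nat m + 1)) (wsh [X0] (replicate m X0)) \<in> ILid"
    using m by (intro qv.subspace_scale[OF subspace_ILid] wsh_in_ILid) auto
  moreover have "(of_nat m + 1 :: rat) \<noteq> 0" by (metis of_nat_Suc of_nat_eq_0_iff add.commute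
      nat.distinct(1))
  ultimately show ?thesis by (simp add: * m)
qed

lemma nth_alt01: "i < 2 * k \<Longrightarrow> alt01 k ! i = (if even i then X0 else X1)"
proof (induction k arbitrary: i)
  case (Suc k)
  show ?case
  proof (cases "i < 2")
    case True
    then have "i = 0 \<or> i = 1" by auto
    then show ?thesis by auto
  next
    case False
    then obtain i' where "i = Suc (Suc i')" by (metis One_nat_def Suc_1 add_2_eq_Suc le_Suc_ex
        not_less)
    then show ?thesis using Suc by simp
  qed
qed simp

text \<open>The padded word still alternates, and the neighbours of an interval of odd length have
  even distance, so they coincide.\<close>

lemma interval_D_alt01:
  assumes "odd n"
  shows "interval_D n X1 (alt01 k) = 0"
  unfolding interval_D_def
proof (rule sum.neutral, rule ballI)
  fix s assume "s \<in> {..<Suc (length (alt01 k)) - n}"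
  then have s: "s + n \<le> 2 * k" by auto
  have "last (X1 # take s (alt01 k)) = (if even s then X1 else X0)"
    using s odd_pos[OF assms] by (cases s) (auto simp: last_conv_nth nth_alt01 min_def
        simp flip: length_0_conv)
  moreover have "hd (drop (s + n) (alt01 k) @ [X0]) = (if even (s + n) then X0 else X1)"
  proof (cases "s + n = 2 * k")
    case True
    then show ?thesis by simp
  next
    case False
    then show ?thesis using s by (simp add: hd_append hd_drop_conv_nth nth_alt01)
  qed
  ultimately show "sc (bdry (last (X1 # take s (alt01 k))) - bdry (hd (drop (s + n) (alt01 k) @
      [X0])))
        (wd (take n (drop s (alt01 k)), take s (alt01 k) @ drop (s + n) (alt01 k))) = 0"
    using assms by simp
qed

lemma zw_eq: "zw (Suc m) = replicate m X0 @ [X1]"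
  by (simp add: zw_def iota_simps)

text \<open>An interval that misses the final \<open>X1\<close> is a power of \<open>X0\<close>,
  hence a product. One that contains it has right neighbour \<open>X0\<close>, so a nonzero
  coefficient needs left neighbour \<open>X1\<close>, that is, the whole word.\<close>

lemma interval_D_zw:
  assumes n: "n \<ge> 2"
  shows "interval_D n X1 (zw (Suc m)) - (if n = Suc m then wd (zw n, []) else 0) \<in> ILtens n"
proof -
  let ?e = "zw (Suc m)"
  define T where "T s = sc (bdry (last (X1 # take s ?e)) - bdry (hd (drop (s + n) ?e @ [X0])))
        (wd (take n (drop s ?e), take s ?e @ drop (s + n) ?e))" for s
  have T: "T s - (if s = 0 \<and> n = Suc m then wd (zw n, []) else 0) \<in> ILtens n"
      if s: "s + n \<le> Suc m" for s
  proof (cases "s + n = Suc m")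
    case False
    then have "take n (drop s ?e) = replicate n X0" using s by (simp add: zw_eq)
    moreover have "tens (wd (replicate n X0)) (wd (take s ?e @ drop (s + n) ?e)) \<in> ILtens n"
      using replicate_X0_ILid[OF n] by (intro tens_in_ILtens) (auto simp: homog_wd)
    ultimately show ?thesis using False by (auto simp: T_def intro: ILtens_sc)
  next
    case True
    then have h: "hd (drop (s + n) ?e @ [X0]) = X0" by (simp add: zw_eq)
    have l: "last (X1 # take s ?e) = (if s = 0 then X1 else X0)"
      using True n by (auto simp: zw_eq)
    show ?thesis
    proof (cases "s = 0")
      case s0: True
      then have "T s = wd (zw n, [])" using True by (simp add: T_def h zw_eq)
      then show ?thesis using s0 True by (simp add: ILtens_0)
    next
      case False
      then show ?thesis using l h by (simp add: T_def ILtens_0)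
    qed
  qed
  have d1: "interval_D n X1 ?e = (\<Sum>s<Suc (Suc m) - n. T s)"
    by (simp add: interval_D_def T_def zw_eq)
  have d2: "(\<Sum>s<Suc (Suc m) - n. if s = 0 \<and> n = Suc m then wd (zw n, []) else 0)
     = (if n = Suc m then wd (zw n, []) else 0)"
  proof (cases "n = Suc m")
    case True
    then show ?thesis by simp
  qed simp
  have "interval_D n X1 ?e - (if n = Suc m then wd (zw n, []) else 0)
    = (\<Sum>s<Suc (Suc m) - n. T s - (if s = 0 \<and> n = Suc m then wd (zw n, []) else 0))"
    unfolding sum_subtractf d1 d2 ..
  also have "\<dots> \<in> ILtens n" by (rule ILtens_sum) (rule T, auto)
  finally show ?thesis .
qed

text \<open>By the derivation property only the term in which \<open>D\<close> acts on the zeta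
  factor remains, since \<open>D\<close> vanishes on \<open>alt01 k\<close>;
  \<open>interval_D_zw\<close> evaluates it.\<close>

lemma Drep_zeta_product:
  assumes "odd n" "n \<ge> 2"
  shows "Drep n (wsh (zw (Suc m)) (alt01 k)) - (if n = Suc m then wd (zw n, alt01 k) else 0)
      \<in> ILtens n"
proof -
  let ?x = "if n = Suc m then wd (zw n, []) else 0"
  have n1: "n \<ge> 1" using assms by simp
  let ?p = "wsh (zw (Suc m)) (alt01 k)"
  have 1: "Drep n ?p - lext (interval_D n X1) ?p \<in> ILtens n" using n1 by (rule Drep_interval_D)
  have 2: "lext (interval_D n X1) ?p - tmap_right (\<lambda>w. wsh w (alt01 k)) (interval_D n X1 (zw (Suc
      m))) \<in> ILtens n"
    using interval_D_derivation[OF n1, of X1 "zw (Suc m)" "alt01 k"] assms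
        by (simp add: interval_D_alt01 tmap_right_lin)
  have 3: "tmap_right (\<lambda>w. wsh w (alt01 k)) (interval_D n X1 (zw (Suc m)) - ?x) \<in> ILtens n"
    using assms by (intro tmap_right_ILtens interval_D_zw)
  have "tmap_right (\<lambda>w. wsh w (alt01 k)) ?x = (if n = Suc m then wd (zw n, alt01 k) else 0)"
    by (simp add: tmap_right_lin)
  then show ?thesis using ILtens_add[OF ILtens_add[OF 1 2] 3] by (simp add: tmap_right_lin(3))
qed

text \<open>Inserting \<open>X0\<close> before or after the \<open>X0\<close> of a block gives the
  same word, whence the coefficient 2. Only insertion at the very end leaves no block behind the new
  letter.\<close>

lemma shuffle_X0_alt01:
  "wsh [X0] (alt01 r) - wd (alt01 r @ [X0]) \<in> qv.span {wd (alt01 i @ X0 # alt01 (Suc j)) | i j.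
      Suc (i + j) = r}"
proof (induction r)
  case 0
  then show ?case by (simp add: qv.span_zero)
next
  case (Suc r)
  let ?S = "\<lambda>r. {wd (alt01 i @ X0 # alt01 (Suc j)) | i j. Suc (i + j) = r}"
  let ?c = "\<lambda>w :: word. wd (X0 # X1 # w)"
  have "wsh [X0] (alt01 (Suc r)) - wd (alt01 (Suc r) @ [X0])
     = sc 2 (wd (alt01 0 @ X0 # alt01 (Suc r))) + lext ?c (wsh [X0] (alt01 r) - wd (alt01 r @
         [X0]))"
  proof -
    have "sc 2 x = x + x" for x :: qpoly
      using qv.scale_left_distrib[of 1 1 x] by simp
    then show ?thesis by (simp add: wsh_Cons pcons_def lext_lin lext_lext)
  qed
  also have "\<dots> \<in> qv.span (?S (Suc r))"
  proof (rule qv.span_add)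
    have "wd (alt01 0 @ X0 # alt01 (Suc r)) \<in> ?S (Suc r)"
        by (rule CollectI, rule exI[of _ 0], rule exI[of _ r]) simp
    then show "sc 2 (wd (alt01 0 @ X0 # alt01 (Suc r))) \<in> qv.span (?S (Suc r))"
      by (intro qv.span_scale qv.span_base)
    show "lext ?c (wsh [X0] (alt01 r) - wd (alt01 r @ [X0])) \<in> qv.span (?S (Suc r))"
    proof (rule lext_span[OF Suc.IH])
      fix x assume "x \<in> ?S r"
      then obtain i j where ij: "x = wd (alt01 i @ X0 # alt01 (Suc j))" "Suc (i + j) = r" by blast
      then have "lext ?c x = wd (alt01 (Suc i) @ X0 # alt01 (Suc j)) \<and> Suc (Suc i + j)
          = Suc r" by simp
      then have "lext ?c x \<in> ?S (Suc r)" by blast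
      then show "lext ?c x \<in> qv.span (?S (Suc r))" by (rule qv.span_base)
    qed simp
  qed
  finally show ?case .
qed

lemma count_0_replicate: "set ks \<subseteq> {2, 3} \<Longrightarrow> count_list ks 3 = 0 \<Longrightarrow> ks
    = replicate (length ks) (2 :: nat)"
  by (induction ks) (auto split: if_splits)

lemma iota_one_3: "iota (replicate i 2 @ 3 # replicate j 2) = alt01 i @ X0 # alt01 (Suc j)"
  by (simp add: iota_append iota_23 alt01_def)

theorem level_one_in_zeta_line:
  assumes kc: kernel_conjecture and "i + j \<ge> 1"
  shows "wd (alt01 i @ X0 # alt01 j) \<in> zeta_line (2 * (i + j) + 1)"
  using assms(2)
proof (induction "i + j" arbitrary: i j rule: less_induct)
  case less
  define r where "r = i + j"
  define M where "M = 2 * r + 1"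
  have IH: "wd (alt01 i' @ X0 # alt01 j') \<in> zeta_line (2 * q + 1)" if "i' + j'
      = q" "1 \<le> q" "q < r" for i' j' q
    using less.hyps[of i' j'] that by (simp add: r_def)
  have step: "wd (alt01 i @ X0 # alt01 (Suc j)) \<in> zeta_line M" if r: "i + Suc j = r" for i j
  proof -
    let ?ks = "replicate i 2 @ 3 # replicate j (2 :: nat)"
    let ?e = "iota ?ks"
    have c1: "count_list ?ks 3 = 1" by simp
    have ks: "set ?ks \<subseteq> {2, 3}" by auto
    have sl: "sum_list ?ks = M" using r by (simp add: M_def sum_list_replicate)
    have "\<exists>c. Drep (2 * q + 1) (wd ?e) - sc c (wd (zw (2 * q + 1), alt01 (r - q)))
        \<in> ILtens (2 * q + 1)"
      if q: "q \<in> {1..<r}" for q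
    proof -
      let ?n = "2 * q + 1"
      let ?A = "{wd (zw ?n, iota ks') | ks'. set ks' \<subseteq> {2, 3} \<and> sum_list ks' + ?n = sum_list ?ks
          \<and> count_list ks' 3 + 1 = count_list ?ks 3}"
      let ?B = "{wd (f, iota ks') | f ks'. length f = ?n \<and> set ks' \<subseteq> {2, 3}
          \<and> count_list ks' 3 + 2 \<le> count_list ?ks 3}"
      \<comment> \<open>The word has a single 3, so no cut can lose two.\<close>
      have B: "?B = {}" by (simp add: c1)
      \<comment> \<open>Losing the only 3 leaves a list of 2's, and the weight fixes its
        length.\<close>
      have A: "?A \<subseteq> {wd (zw ?n, alt01 (r - q))}"
      proof
        fix x assume "x \<in> ?A"
        then obtain ks' where k: "x = wd (zw ?n, iota ks')" "set ks' \<subseteq> {2, 3}"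
          "sum_list ks' + ?n = sum_list ?ks" "count_list ks' 3 + 1 = count_list ?ks 3" by blast
        then have rep: "ks' = replicate (length ks') 2"
          unfolding c1 by (intro count_0_replicate) auto
        have "sum_list ks' = 2 * length ks'" by (subst rep) (simp add: sum_list_replicate)
        then have "length ks' = r - q" using k(3) unfolding sl M_def by linarith
        then show "x \<in> {wd (zw ?n, alt01 (r - q))}" using k(1) rep by (metis alt01_def singletonI)
      qed
      have Sp: "wd (alt01 i' @ X0 # alt01 j') \<in> zeta_line ?n" if "i' + j' = q" for i' j'
        using IH[OF that] q by simp
      have "interval_D ?n X1 ?e \<in> qv.span (ILtens ?n \<union> ?A \<union> ?B)"
        by (rule interval_D_23_word[OF ks Sp])
      also have "\<dots> \<subseteq> qv.span (insert (wd (zw ?n, alt01 (r - q))) (ILtens ?n))"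
        unfolding B
        by (intro qv.span_mono Un_least subset_insertI subset_trans[OF A] empty_subsetI) simp
      finally obtain c where "interval_D ?n X1 ?e - sc c (wd (zw ?n, alt01 (r - q))) \<in> ILtens ?n"
        unfolding qv.span_insert by (auto simp: qv.span_eq_iff[THEN iffD2, OF subspace_ILtens])
      then have "(Drep ?n (wd ?e) - interval_D ?n X1 ?e) + (interval_D ?n X1 ?e - sc c
          (wd (zw ?n, alt01 (r - q)))) \<in> ILtens ?n"
        by (intro ILtens_add Drep_wd_interval_D) auto
      then show ?thesis by auto
    qed
    then obtain c where c: "\<And>q. q \<in> {1..<r} \<Longrightarrow>
        Drep (2 * q + 1) (wd ?e) - sc (c q) (wd (zw (2 * q + 1), alt01 (r - q)))
            \<in> ILtens (2 * q + 1)"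
      by metis
    define P where "P q = wsh (zw (Suc (2 * q))) (alt01 (r - q))" for q
    \<comment> \<open>The coefficients \<open>c q\<close> are those found in the images under the
      lower \<open>D\<close>; subtracting \<open>S\<close> cancels all of them at once, as
      \<open>D\<close> in weight \<open>2 * q + 1\<close> sees only the product
      \<open>P q\<close>.\<close>
    define S where "S = (\<Sum>q\<in>{1..<r}. sc (c q) (P q))"
    have hP: "homog M (P q)" if "q < r" for q
    proof -
      have "length (zw (Suc (2 * q))) + length (alt01 (r - q)) = M"
        using that by (simp add: M_def zw_eq)
      then show ?thesis using homog_wsh[of "zw (Suc (2 * q))" "alt01 (r - q)"] by (simp add: P_def)
    qed
    have "homog M (wd ?e - S)"
      unfolding S_def
    proof (intro homog_diff homog_sum homog_sc)
      show "homog M (wd ?e)" using sl by (simp add: homog_wd length_iota)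
    qed (auto intro: hP)
    moreover have "Drep (2 * q + 1) (wd ?e - S) \<in> Krel (2 * q + 1)" if q: "q \<in> {1..<r}" for q
    proof -
      let ?n = "2 * q + 1" and ?x = "wd (zw (2 * q + 1), alt01 (r - q))"
      have 1: "Drep ?n (P t) - (if t = q then ?x else 0) \<in> ILtens ?n" for t
        using Drep_zeta_product[of ?n "2 * t" "r - t"] q by (auto simp: P_def split: if_splits)
      have "sc (c q) ?x = (\<Sum>t\<in>{1..<r}. sc (c t) (if t = q then ?x else 0))"
        using q by (simp add: if_distrib cong: if_cong)
      then have "Drep ?n S - sc (c q) ?x = (\<Sum>t\<in>{1..<r}. sc (c t) (Drep ?n (P t) - (if t = q
          then ?x else 0)))"
        unfolding S_def Drep_lin qv.scale_right_diff_distrib sum_subtractf by simp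
      also have "\<dots> \<in> ILtens ?n" by (intro ILtens_sum ILtens_sc 1)
      finally have "(Drep ?n (wd ?e) - sc (c q) ?x) - (Drep ?n S - sc (c q) ?x) \<in> ILtens ?n"
        by (rule ILtens_diff[OF c[OF q]])
      then show ?thesis using ILtens_subset_Krel by (auto simp: Drep_lin)
    qed
    moreover have "M \<ge> 2" using r by (simp add: M_def)
    moreover have "q \<in> {1..<r}" if "q \<ge> 1" "2 * q + 1 < M" for q
      using that by (simp add: M_def)
    ultimately obtain d where "(wd ?e - S) - sc d (wd (zw M)) \<in> Rid"
      using kc[unfolded kernel_conjecture_def, rule_format, of M "wd ?e - S"] by blast
    then have "(wd ?e - S) - sc d (wd (zw M)) \<in> ILid" using Rid_subset_ILid by blast
    \<comment> \<open>The correction is a sum of products, so it does not change the class modulo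
      \<open>ILid\<close>.\<close>
    moreover have "S \<in> ILid"
      unfolding S_def P_def
      by (intro qv.subspace_sum qv.subspace_scale subspace_ILid wsh_in_ILid)
        (auto simp: zw_eq simp flip: length_0_conv)
    ultimately have "((wd ?e - S) - sc d (wd (zw M))) + S \<in> ILid"
      by (rule qv.subspace_add[OF subspace_ILid])
    then have "wd ?e - sc d (wd (zw M)) \<in> ILid" by (simp add: algebra_simps)
    then show ?thesis unfolding zeta_line_iff iota_one_3 by blast
  qed
  show ?case
  proof (cases j)
    case (Suc j')
    then show ?thesis using step[of i j'] by (simp add: M_def r_def)
  next
    case 0
    \<comment> \<open>The word ends in \<open>X0\<close>. It differs from a product by words with a
      trailing block, which \<open>step\<close> covers in the same weight.\<close>
    have "wsh [X0] (alt01 r) - wd (alt01 r @ [X0]) \<in> zeta_line M"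
      using shuffle_X0_alt01[of r]
      by (rule subsetD[OF qv.span_minimal[OF _ subspace_zeta_line], rotated]) (auto intro: step
          simp del: alt01_simps)
    moreover have "wsh [X0] (alt01 r) \<in> zeta_line M"
      using less.prems by (intro ILid_subset_zeta_line wsh_in_ILid) (auto simp: r_def
          simp flip: length_0_conv)
    ultimately have "wsh [X0] (alt01 r) - (wsh [X0] (alt01 r) - wd (alt01 r @ [X0])) \<in> zeta_line M"
      using qv.subspace_diff[OF subspace_zeta_line] by blast
    then show ?thesis using 0 by (simp add: M_def r_def)
  qed
qed

section \<open>From single words to the level filtration\<close>

theorem mainTheorem19:
  fixes r l N :: nat
  assumes "kernel_conjecture"
    and "r \<ge> 1" and "l \<ge> 1" and "N \<ge> 2 * r + 1"
  shows "\<forall>p \<in> Fw (int l) N.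
     (\<exists>v \<in> LTens (2 * r + 1) (Fall (int l - 1)).
         Drep (2 * r + 1) p - v \<in> Krel (2 * r + 1))
   \<and> (\<exists>u \<in> Fw (int l - 1) (N - (2 * r + 1)). \<exists>v \<in> LTens (2 * r + 1) (Fall (int l - 2)).
         Drep (2 * r + 1) p - tens (wd (zw (2 * r + 1))) u - v \<in> Krel (2 * r + 1))"
proof
  fix p assume p: "p \<in> Fw (int l) N"
  let ?n = "2 * r + 1"
  let ?U = "Fw (int l - 1) (N - ?n)" and ?V = "LTens ?n (Fall (int l - 2))" and ?K = "Krel ?n"
  let ?z = "wd (zw ?n)"
  \<comment> \<open>The tensors satisfying the second claim form a subspace containing
    \<open>ILtens\<close>, so it suffices to treat \<open>interval_D\<close> of single
    words.\<close>
  define G where "G = {T. \<exists>u\<in>?U. \<exists>v\<in>?V. T - tens ?z u - v \<in> ?K}"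
  have sub: "qv.subspace ?U" "qv.subspace ?V" "qv.subspace ?K"
    by (simp_all add: Fw_def LTens_def Krel_def lspan_eq_span)
  have G: "qv.subspace G"
  proof (rule qv.subspaceI)
    show "0 \<in> G" unfolding G_def using qv.subspace_0[OF sub(1)] qv.subspace_0[OF sub(2)]
        qv.subspace_0[OF sub(3)]
      by (auto intro!: bexI[of _ 0])
  next
    fix S T assume "S \<in> G" "T \<in> G"
    then obtain u v u' v' where uv: "u \<in> ?U" "v \<in> ?V" "S - tens ?z u - v \<in> ?K"
      "u' \<in> ?U" "v' \<in> ?V" "T - tens ?z u' - v' \<in> ?K" unfolding G_def by blast
    have "(S + T) - tens ?z (u + u') - (v + v') = (S - tens ?z u - v) + (T - tens ?z u' - v')"
      by (simp add: tens_add_right)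
    also have "\<dots> \<in> ?K" using uv by (intro qv.subspace_add[OF sub(3)])
    finally show "S + T \<in> G"
      unfolding G_def using qv.subspace_add[OF sub(1)] qv.subspace_add[OF sub(2)] uv by blast
  next
    fix c T assume "T \<in> G"
    then obtain u v where uv: "u \<in> ?U" "v \<in> ?V" "T - tens ?z u - v \<in> ?K" unfolding G_def by blast
    have "sc c T - tens ?z (sc c u) - sc c v = sc c (T - tens ?z u - v)"
      by (simp add: tens_sc_right qv.scale_right_diff_distrib)
    also have "\<dots> \<in> ?K" using uv by (intro qv.subspace_scale[OF sub(3)])
    finally show "sc c T \<in> G"
      unfolding G_def using qv.subspace_scale[OF sub(1)] qv.subspace_scale[OF sub(2)] uv by blast
  qed
  have Sp: "wd (alt01 i @ X0 # alt01 j) \<in> zeta_line ?n" if "i + j = r" for i j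
    using level_one_in_zeta_line[OF assms(1), of i j] that assms(2) by simp
  have z0: "0 \<in> ?U" "0 \<in> ?V" "0 \<in> ?K" using sub by (simp_all add: qv.subspace_0)
  have KG: "ILtens ?n \<subseteq> G"
  proof
    fix T assume "T \<in> ILtens ?n"
    then have "T - tens ?z 0 - 0 \<in> ?K" using ILtens_subset_Krel by auto
    then show "T \<in> G" unfolding G_def using z0 by blast
  qed
  have word: "Drep ?n (wd (iota ks)) \<in> G"
    if ks: "set ks \<subseteq> {2, 3}" "sum_list ks = N" "int (count_list ks 3) \<le> int l" for ks
  proof -
    \<comment> \<open>Cuts losing one 3 supply \<open>u\<close>, cuts losing at least two supply
      \<open>v\<close>.\<close>
    have "interval_D ?n X1 (iota ks) \<in> G"
    proof (rule subsetD[OF qv.span_minimal[OF _ G] interval_D_23_word[OF ks(1) Sp]], goal_cases)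
      case 1
      show ?case
      proof (intro Un_least KG subsetI)
        fix x assume "x \<in> {wd (zw ?n, iota ks') | ks'. set ks' \<subseteq> {2, 3} \<and> sum_list ks' + ?n
            = sum_list ks
          \<and> count_list ks' 3 + 1 = count_list ks 3}"
        then obtain ks' where k: "x = wd (zw ?n, iota ks')" "set ks' \<subseteq> {2, 3}"
          "sum_list ks' + ?n = sum_list ks" "count_list ks' 3 + 1 = count_list ks 3" by blast
        then have "wd (iota ks') \<in> zgen (int l - 1) (N - ?n)"
          unfolding zgen_def using ks by auto
        then have "wd (iota ks') \<in> ?U" unfolding Fw_def lspan_eq_span by (rule qv.span_base)
        moreover have "x - tens ?z (wd (iota ks')) - 0 \<in> ?K" using z0(3) by (simp add: k(1))
        ultimately show "x \<in> G" unfolding G_def using z0 by blast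
      next
        fix x :: qtens assume "x \<in> {wd (f, iota ks') | f ks'. length f = ?n \<and> set ks' \<subseteq> {2, 3}
          \<and> count_list ks' 3 + 2 \<le> count_list ks 3}"
        then obtain f :: word and ks' where k: "x = wd (f, iota ks')" "length f = ?n" "set ks'
            \<subseteq> {2, 3}"
          "count_list ks' 3 + 2 \<le> count_list ks 3" by blast
        then have "wd (iota ks') \<in> zgen (int l - 2) (sum_list ks')"
          unfolding zgen_def using ks by auto
        then have "wd (iota ks') \<in> Fall (int l - 2)"
          unfolding Fall_def lspan_eq_span by (intro qv.span_base) blast
        moreover have "x = tens (wd f) (wd (iota ks'))" "homog ?n (wd f)" using k
            by (auto simp: homog_wd)
        ultimately have "x \<in> ?V" unfolding LTens_def lspan_eq_span by (intro qv.span_base) blast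
        moreover have "x - tens ?z 0 - x \<in> ?K" using z0(3) by simp
        ultimately show "x \<in> G" unfolding G_def using z0 by blast
      qed
    qed simp_all
    moreover have "Drep ?n (wd (iota ks)) - interval_D ?n X1 (iota ks) \<in> G"
      using KG Drep_wd_interval_D[of ?n "iota ks"] by auto
    ultimately have "(Drep ?n (wd (iota ks)) - interval_D ?n X1 (iota ks)) + interval_D ?n X1
        (iota ks) \<in> G"
      using qv.subspace_add[OF G] by blast
    then show ?thesis by simp
  qed
  have "Drep ?n p \<in> G"
    unfolding Drep_lext[of ?n p]
  proof (rule lext_span[OF p[unfolded Fw_def lspan_eq_span] _ G])
    fix s assume "s \<in> zgen (int l) N"
    then obtain ks where "s = wd (iota ks)" "set ks \<subseteq> {2, 3}" "sum_list ks
        = N" "int (count_list ks 3) \<le> int l"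
      unfolding zgen_def by blast
    then show "lext (\<lambda>w. Drep ?n (wd w)) s \<in> G" using word by simp
  qed
  then obtain u v where uv: "u \<in> ?U" "v \<in> ?V" "Drep ?n p - tens ?z u - v \<in> ?K"
    unfolding G_def by blast
  \<comment> \<open>The first claim follows from the second: both summands found there have right
    factors of level at most \<open>l - 1\<close>.\<close>
  let ?W = "LTens ?n (Fall (int l - 1))"
  have "u \<in> Fall (int l - 1)"
    using uv(1) qv.span_mono[of "zgen (int l - 1) (N - ?n)" "\<Union>N. zgen (int l - 1) N"]
    unfolding Fw_def Fall_def lspan_eq_span by blast
  moreover have "homog ?n ?z" by (simp add: homog_wd zw_eq)
  ultimately have 1: "tens ?z u \<in> ?W"
    unfolding LTens_def lspan_eq_span by (intro qv.span_base) blast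
  have "zgen (int l - 2) N' \<subseteq> zgen (int l - 1) N'" for N' unfolding zgen_def by fastforce
  then have "Fall (int l - 2) \<subseteq> Fall (int l - 1)"
    unfolding Fall_def lspan_eq_span by (intro qv.span_mono) blast
  then have "?V \<subseteq> ?W" unfolding LTens_def lspan_eq_span by (intro qv.span_mono) blast
  then have "tens ?z u + v \<in> ?W"
    using 1 uv(2) unfolding LTens_def lspan_eq_span by (intro qv.span_add) auto
  moreover have "Drep ?n p - (tens ?z u + v) \<in> ?K" using uv(3) by (simp add: diff_diff_eq)
  ultimately show "(\<exists>v\<in>?W. Drep ?n p - v \<in> ?K) \<and> (\<exists>u\<in>?U. \<exists>v\<in>?V. Drep ?n p - tens ?z u - v \<in> ?K)"
    using uv by blast
qed

end
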